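(* There is a function $\varepsilon_d$ with $\varepsilon_d\to0$ as $d\to\infty$ such that for $\varepsilon_d\leq\varepsilon\leq1-\varepsilon_d$ and $k=(1+\varepsilon)\frac{\ln d}{d}\cdot n$, with high probability a pair $(G,\sigma)$ chosen from $\mathcal{U}_k(n,m)$ is not $(\gamma,\delta)$-expandable for any $\gamma>\varepsilon_d$ and $$\delta<\gamma+\frac{2(\varepsilon-\varepsilon_d)}{1+\varepsilon}.$$
   Context: $G(n,m)$ is the random graph on $V=\{1,\dots,n\}$ with $m$ edges chosen uniformly without replacement; $d=2m/n$ is fixed as $n\to\infty$. "With high probability" means with probability tending to $1$ as $n\to\infty$. $\mathcal{S}_k(G)$ is the set of independent sets of size exactly $k$ in $G$, and $\alpha(G)$ the independence number. $\Lambda_k(n,m)$ is the set of pairs $(G,\sigma)$ with $G$ a graph on $V$ with $m$ edges and $\sigma$ an independent set of $G$ of size $k$. $\mathcal{U}_k(n,m)$ is the distribution on $\Lambda_k(n,m)$ given by: choose $G=G(n,m)$; if $\alpha(G)\geq k$, choose $\sigma\in\mathcal{S}_k(G)$ uniformly at random. For $\gamma,\delta\geq0$, a pair $(G,\sigma)$ is $(\gamma,\delta)$-expandable if $G$ has an independent set $\tau$ with $|\tau|\geq(1+\gamma)|\sigma|$ and $|\tau\cap\sigma|\geq(1-\delta)|\sigma|$. *)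

theory Defs
  imports "HOL-Probability.Probability"
begin

text \<open>Simple graphs on the vertex set V = {1..n}: a graph is its edge set, a set of
  2-element subsets of V.\<close>

definition all_edges :: "nat \<Rightarrow> nat set set" where
  "all_edges n = {e. e \<subseteq> {1..n} \<and> card e = 2}"

definition graphs :: "nat \<Rightarrow> nat \<Rightarrow> nat set set set" where
  "graphs n m = {E. E \<subseteq> all_edges n \<and> card E = m}"

definition is_indep :: "nat \<Rightarrow> nat set set \<Rightarrow> nat set \<Rightarrow> bool" where
  "is_indep n E S \<longleftrightarrow> S \<subseteq> {1..n} \<and> (\<forall>e\<in>E. \<not> e \<subseteq> S)"

definition indep_sets :: "nat \<Rightarrow> nat set set \<Rightarrow> nat \<Rightarrow> nat set set" where
  "indep_sets n E k = {S. is_indep n E S \<and> card S = k}"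

definition Gnm :: "nat \<Rightarrow> nat \<Rightarrow> nat set set pmf" where
  "Gnm n m = pmf_of_set (graphs n m)"

text \<open>The distribution U_k(n,m). The outcome None represents the case alpha(G) < k,
  in which no pair (G,sigma) is produced.\<close>
definition U :: "nat \<Rightarrow> nat \<Rightarrow> nat \<Rightarrow> (nat set set \<times> nat set) option pmf" where
  "U n m k = do {
     E \<leftarrow> Gnm n m;
     if indep_sets n E k = {} then return_pmf None
     else map_pmf (\<lambda>\<sigma>. Some (E, \<sigma>)) (pmf_of_set (indep_sets n E k)) }"

definition expandable :: "nat \<Rightarrow> nat set set \<Rightarrow> nat set \<Rightarrow> real \<Rightarrow> real \<Rightarrow> bool" where
  "expandable n E \<sigma> \<gamma> \<delta> \<longleftrightarrow>
     (\<exists>\<tau>. is_indep n E \<tau> \<and> real (card \<tau>) \<ge> (1 + \<gamma>) * real (card \<sigma>)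
          \<and> real (card (\<tau> \<inter> \<sigma>)) \<ge> (1 - \<delta>) * real (card \<sigma>))"

end

theory Submission
  imports Defs "HOL-Real_Asymp.Real_Asymp"
begin

text \<open>
  If \<open>Z\<close> counts the independent sets of size \<open>k\<close>, then a uniformly chosen one is expandable with
  probability at most \<open>P(Z < L) + E(number of expandable sets) / L\<close> for every \<open>L\<close>. Both terms are
  exponentially small in the binomial random graph of edge probability \<open>m / (n choose 2)\<close>, which has
  exactly \<open>m\<close> edges with probability at least \<open>1 / ((n choose 2) + 1)\<close>, and so they are small in \<open>G(n, m)\<close> as well.

  The first moment of pairs \<open>(\<sigma>, \<tau>)\<close> of independent sets with \<open>\<bar>\<tau> \<inter> \<sigma>\<bar> = a\<close> and \<open>\<bar>\<tau> - \<sigma>\<bar> = b\<close> is small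
  compared with \<open>E Z\<close>: each of the \<open>b\<close> new vertices contributes a factor of at most \<open>e n / b\<close> for its choice but
  loses a factor \<open>exp (- d (2 a + b) / (2 n))\<close>, and expandability forces \<open>2 a + b\<close> to be so large that the
  loss wins by a factor \<open>d powr \<eta>\<close>.

  For the lower tail of \<open>Z\<close>, the second moment method shows with exponentially small but controlled
  probability that there are many independent sets of size slightly larger than \<open>k\<close>. By Talagrand's
  inequality for the Hamming distance (exposing the graph vertex by vertex), almost every graph agrees
  with such a graph up to the edges at few vertices; deleting these vertices leaves many independent
  sets of size \<open>k\<close>.
\<close>

section \<open>Random subsets and blow-up\<close>

text \<open>The expectation of \<open>f\<close> under the random subset of \<open>X\<close> that contains each element
  independently with probability \<open>p\<close>; for \<open>X = all_edges n\<close> this is the binomial random graph.\<close>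

definition subset_expect :: "real \<Rightarrow> 'a set \<Rightarrow> ('a set \<Rightarrow> real) \<Rightarrow> real" where
  "subset_expect p X f = (\<Sum>E\<in>Pow X. p ^ card E * (1 - p) ^ card (X - E) * f E)"

text \<open>Independence of the choices made on disjoint sets, in Fubini form. It permits exposing
  the random set one block at a time.\<close>

lemma subset_expect_Un:
  assumes "finite X" "finite Y" "X \<inter> Y = {}"
  shows "subset_expect p (X \<union> Y) f
    = subset_expect p X (\<lambda>E. subset_expect p Y (\<lambda>F. f (E \<union> F)))"
proof -
  have bij: "bij_betw (\<lambda>(E, F). E \<union> F) (Pow X \<times> Pow Y) (Pow (X \<union> Y))"
    by (rule bij_betw_byWitness[where f' = "\<lambda>E. (E \<inter> X, E \<inter> Y)"]) (use assms(3) in auto)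
  have wt: "p ^ card (E \<union> F) * (1 - p) ^ card (X \<union> Y - (E \<union> F))
      = (p ^ card E * (1 - p) ^ card (X - E)) * (p ^ card F * (1 - p) ^ card (Y - F))"
    if "E \<subseteq> X" "F \<subseteq> Y" for E F
  proof -
    have "card (E \<union> F) = card E + card F"
      by (rule card_Un_disjoint) (use that assms in \<open>auto intro: finite_subset\<close>)
    moreover have "X \<union> Y - (E \<union> F) = (X - E) \<union> (Y - F)"
      using that assms(3) by auto
    moreover have "card ((X - E) \<union> (Y - F)) = card (X - E) + card (Y - F)"
      by (rule card_Un_disjoint) (use assms in auto)
    ultimately show ?thesis
      by (simp add: power_add)
  qed
  have "subset_expect p (X \<union> Y) f = (\<Sum>(E, F)\<in>Pow X \<times> Pow Y.
      p ^ card (E \<union> F) * (1 - p) ^ card (X \<union> Y - (E \<union> F)) * f (E \<union> F))"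
    unfolding subset_expect_def sum.reindex_bij_betw[OF bij, symmetric]
    by (simp add: case_prod_unfold)
  also have "\<dots> = (\<Sum>(E, F)\<in>Pow X \<times> Pow Y. (p ^ card E * (1 - p) ^ card (X - E)) *
      (p ^ card F * (1 - p) ^ card (Y - F) * f (E \<union> F)))"
    by (intro sum.cong) (auto simp: wt mult_ac)
  also have "\<dots> = subset_expect p X (\<lambda>E. subset_expect p Y (\<lambda>F. f (E \<union> F)))"
    by (simp add: subset_expect_def sum.cartesian_product[symmetric] sum_distrib_left)
  finally show ?thesis .
qed

lemma subset_expect_empty [simp]: "subset_expect p {} f = f {}"
  by (simp add: subset_expect_def)

lemma subset_expect_const:
  assumes "finite X"
  shows "subset_expect p X (\<lambda>E. c) = c"
  using assms
proof (induction X)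
  case (insert x X)
  have "subset_expect p {x} (\<lambda>F. c) = c"
    by (simp add: subset_expect_def Pow_insert algebra_simps)
  with insert subset_expect_Un[of "{x}" X p "\<lambda>E. c"] show ?case
    by simp
qed simp

lemma subset_expect_cong:
  assumes "\<And>E. E \<subseteq> X \<Longrightarrow> f E = g E"
  shows "subset_expect p X f = subset_expect p X g"
  unfolding subset_expect_def by (intro sum.cong) (use assms in auto)

lemma subset_expect_mono:
  assumes "0 \<le> p" "p \<le> 1" "\<And>E. E \<subseteq> X \<Longrightarrow> f E \<le> g E"
  shows "subset_expect p X f \<le> subset_expect p X g"
  unfolding subset_expect_def by (intro sum_mono mult_left_mono) (use assms in auto)

lemma subset_expect_add:
  "subset_expect p X (\<lambda>E. f E + g E) = subset_expect p X f + subset_expect p X g"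
  by (simp add: subset_expect_def sum.distrib algebra_simps)

lemma subset_expect_diff:
  "subset_expect p X (\<lambda>E. f E - g E) = subset_expect p X f - subset_expect p X g"
  by (simp add: subset_expect_def sum_subtractf algebra_simps)

lemma subset_expect_cmult:
  "subset_expect p X (\<lambda>E. c * f E) = c * subset_expect p X f"
  by (simp add: subset_expect_def sum_distrib_left algebra_simps)

lemma subset_expect_sum:
  "subset_expect p X (\<lambda>E. \<Sum>i\<in>I. f i E) = (\<Sum>i\<in>I. subset_expect p X (f i))"
  unfolding subset_expect_def sum_distrib_left by (rule sum.swap)

text \<open>Only the choices inside \<open>S\<close> matter: the rest integrates to 1, and the empty
  set is the only subset of \<open>S\<close> that survives.\<close>

lemma subset_expect_avoid:
  assumes "finite X" "S \<subseteq> X"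
  shows "subset_expect p X (\<lambda>E. of_bool (E \<inter> S = {})) = (1 - p) ^ card S"
proof -
  have fS: "finite S"
    using assms finite_subset by blast
  have X: "X = S \<union> (X - S)"
    using assms by auto
  have "subset_expect p X (\<lambda>E. of_bool (E \<inter> S = {}))
      = subset_expect p S (\<lambda>E. subset_expect p (X - S) (\<lambda>F. of_bool ((E \<union> F) \<inter> S = {})))"
    by (subst X, rule subset_expect_Un) (use assms fS in auto)
  also have "\<dots> = subset_expect p S (\<lambda>E. of_bool (E = {}))"
  proof (rule subset_expect_cong)
    fix E assume E: "E \<subseteq> S"
    have "subset_expect p (X - S) (\<lambda>F. of_bool ((E \<union> F) \<inter> S = {}) :: real)
        = subset_expect p (X - S) (\<lambda>F. of_bool (E = {}))"
      by (rule subset_expect_cong) (use E in auto)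
    then show "subset_expect p (X - S) (\<lambda>F. of_bool ((E \<union> F) \<inter> S = {}))
        = (of_bool (E = {}) :: real)"
      using assms by (simp add: subset_expect_const)
  qed
  also have "\<dots> = (\<Sum>E\<in>Pow S. if E = {} then (1 - p) ^ card S else 0)"
    unfolding subset_expect_def by (intro sum.cong) auto
  also have "\<dots> = (1 - p) ^ card S"
    using fS by simp
  finally show ?thesis .
qed

text \<open>Values of \<open>f\<close> below half its mean contribute at most half of the mean, so
  the event carries the other half, which Cauchy-Schwarz bounds by the second moment and the
  probability of the event. The product form avoids dividing by a second moment that may
  vanish.\<close>

lemma Paley_Zygmund_half:
  assumes "finite X" "0 \<le> p" "p \<le> 1" "\<And>E. E \<subseteq> X \<Longrightarrow> 0 \<le> f E"
  shows "(subset_expect p X f)\<^sup>2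
    \<le> 4 * subset_expect p X (\<lambda>E. (f E)\<^sup>2) * subset_expect p X (\<lambda>E. of_bool (subset_expect p X f / 2 \<le> f E))"
proof -
  let ?E = "subset_expect p X"
  define \<mu> where "\<mu> = ?E f"
  define a where "a E = (of_bool (\<mu> / 2 \<le> f E) :: real)" for E
  have \<mu>0: "\<mu> \<ge> 0"
    unfolding \<mu>_def subset_expect_def by (intro sum_nonneg mult_nonneg_nonneg) (use assms in auto)
  have "\<mu> \<le> ?E (\<lambda>E. \<mu> / 2 + f E * a E)"
    unfolding \<mu>_def[symmetric]
    by (subst (1) \<mu>_def, rule subset_expect_mono) (use assms \<mu>0 in \<open>auto simp: a_def\<close>)
  then have half: "\<mu> / 2 \<le> ?E (\<lambda>E. f E * a E)"
    by (simp add: subset_expect_add subset_expect_const[OF assms(1)])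
  have "?E (\<lambda>E. f E * a E) ^ 2 \<le> ?E (\<lambda>E. (f E)\<^sup>2) * ?E a"
  proof -
    \<comment> \<open>The weight is split into two square roots so that Cauchy-Schwarz for plain
      sums applies; \<open>a\<close> takes only the values 0 and 1, hence equals its square.\<close>
    define w where "w E = sqrt (p ^ card E * (1 - p) ^ card (X - E))" for E
    have w2: "w E * w E = p ^ card E * (1 - p) ^ card (X - E)" for E
      unfolding w_def using assms by simp
    have "(\<Sum>E\<in>Pow X. (w E * f E) * (w E * a E)) ^ 2
        \<le> (\<Sum>E\<in>Pow X. (w E * f E)\<^sup>2) * (\<Sum>E\<in>Pow X. (w E * a E)\<^sup>2)"
      by (rule Cauchy_Schwarz_ineq_sum)
    moreover have "(w E * f E) * (w E * a E) = p ^ card E * (1 - p) ^ card (X - E) * (f E * a E)"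
      "(w E * f E)\<^sup>2 = p ^ card E * (1 - p) ^ card (X - E) * (f E)\<^sup>2"
      "(w E * a E)\<^sup>2 = p ^ card E * (1 - p) ^ card (X - E) * a E" for E
      unfolding w2[symmetric] by (auto simp: a_def power2_eq_square)
    ultimately show ?thesis
      by (simp add: subset_expect_def)
  qed
  moreover have "(\<mu> / 2)\<^sup>2 \<le> ?E (\<lambda>E. f E * a E) ^ 2"
    using half \<mu>0 by (intro power_mono) auto
  ultimately show ?thesis
    unfolding \<mu>_def[symmetric] a_def[symmetric] by (simp add: power2_eq_square field_simps)
qed

section \<open>Concentration for the Hamming distance\<close>

text \<open>The left side is the square of cosh (t / 2), so this is cosh s \<le> exp (s^2 / 2) at s
  = t / 2, obtained from Hoeffding's lemma for a fair coin. It gives the cost of one block in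
  \<open>hamming_blow_up\<close>.\<close>

lemma cosh_half_squared_le:
  fixes t :: real
  assumes "t \<ge> 0"
  shows "(1 + exp t)\<^sup>2 / (4 * exp t) \<le> exp (t\<^sup>2 / 4)"
proof -
  have pos: "(1 + exp t) / 2 > 0"
    by (simp add: add_pos_pos)
  have "ln ((1 + exp t) / 2) \<le> t / 2 + t\<^sup>2 / 8"
    using Hoeffdings_lemma_aux[of t "1 / 2"] assms by (simp add: field_simps)
  then have "(1 + exp t) / 2 \<le> exp (t / 2 + t\<^sup>2 / 8)"
    using pos by (metis exp_le_cancel_iff exp_ln)
  then have "((1 + exp t) / 2)\<^sup>2 \<le> (exp (t / 2 + t\<^sup>2 / 8))\<^sup>2"
    using pos by (intro power_mono) auto
  also have "\<dots> = exp t * exp (t\<^sup>2 / 4)"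
    by (simp add: power2_eq_square exp_add[symmetric])
  finally show ?thesis
    by (simp add: field_simps power2_eq_square)
qed

text \<open>Bounds the better of two options, keeping a block or changing it, by an affine function
  of \<open>u\<close>, which can be averaged when only the mean of \<open>u\<close> is known. In the
  second case the inequality is \<open>(1 - u) * (exp t * u - 1) \<ge> 0\<close> divided by
  \<open>u\<close>.\<close>

lemma min_inverse_exp_le:
  fixes u t :: real
  assumes "0 < u" "u \<le> 1" "t \<ge> 0"
  shows "min (1 / u) (exp t) \<le> 1 + exp t * (1 - u)"
proof (cases "exp t * u \<le> 1")
  case True
  then show ?thesis by (simp add: algebra_simps)
next
  case False
  have "0 \<le> (1 - u) * (exp t * u - 1)"
    using False assms by (intro mult_nonneg_nonneg) auto
  then have "1 / u \<le> 1 + exp t * (1 - u)"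
    using assms by (simp add: field_simps)
  then show ?thesis by simp
qed


text \<open>Talagrand's inequality for the Hamming distance: \<open>h E\<close> bounds the number of blocks \<open>B i\<close> on
  which \<open>E\<close> must be changed to enter \<open>A\<close>. In the induction on \<open>I\<close>, a set \<open>F\<close> in the new block may
  either be kept, which leaves the distance to the section of \<open>A\<close> at \<open>F\<close>, or be changed at cost 1,
  which leaves the distance to the union \<open>C\<close> of all sections.\<close>

lemma hamming_blow_up:
  fixes B :: "'v \<Rightarrow> 'a set" and p t :: real
  assumes "finite I" "\<And>i. i \<in> I \<Longrightarrow> finite (B i)" "disjoint_family_on B I"
    and p: "0 < p" "p < 1" and t: "t \<ge> 0" and "A \<subseteq> Pow (\<Union>i\<in>I. B i)" "A \<noteq> {}"
  shows "\<exists>h :: 'a set \<Rightarrow> nat.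
    (\<forall>E. E \<subseteq> (\<Union>i\<in>I. B i) \<longrightarrow> (\<exists>E'\<in>A. card {i\<in>I. E \<inter> B i \<noteq> E' \<inter> B i} \<le> h E)) \<and>
    subset_expect p (\<Union>i\<in>I. B i) (\<lambda>E. exp (t * h E)) *
      subset_expect p (\<Union>i\<in>I. B i) (\<lambda>E. of_bool (E \<in> A)) \<le> exp (card I * t\<^sup>2 / 4)"
  using assms(1-3,7,8)
proof (induction I arbitrary: A)
  case empty
  then have "A = {{}}" by auto
  then show ?case by (intro exI[of _ "\<lambda>_. 0"]) auto
next
  case (insert j I)
  define X where "X = (\<Union>i\<in>I. B i)"
  define Y where "Y = B j"
  define K where "K = exp (card I * t\<^sup>2 / 4)"
  have fin: "finite X" "finite Y"
    using insert.prems insert.hyps by (auto simp: X_def Y_def)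
  have XY: "X \<inter> Y = {}" 
    using insert.prems(2) insert.hyps unfolding X_def Y_def disjoint_family_on_def by fastforce
  have union: "(\<Union>i\<in>insert j I. B i) = X \<union> Y"
    by (auto simp: X_def Y_def)
  have BX: "B i \<subseteq> X" if "i \<in> I" for i
    using that by (auto simp: X_def)
  define sec where "sec F = {E. E \<subseteq> X \<and> E \<union> F \<in> A}" for F
  define C where "C = (\<Union>F\<in>Pow Y. sec F)"
  let ?P = "\<lambda>A. subset_expect p X (\<lambda>E. of_bool (E \<in> A))"
  let ?near = "\<lambda>A h. \<forall>E. E \<subseteq> X \<longrightarrow> (\<exists>E'\<in>A. card {i\<in>I. E \<inter> B i \<noteq> E' \<inter> B i} \<le> h E)"
  have IH: "\<exists>h :: 'a set \<Rightarrow> nat. ?near D h \<and> subset_expect p X (\<lambda>E. exp (t * h E)) * ?P D \<le> K"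
    if "D \<subseteq> Pow X" "D \<noteq> {}" for D
    unfolding X_def K_def
    using insert.IH[of D] insert.prems that by (auto simp: X_def disjoint_family_on_def)
  have pos: "?P D > 0" if "D \<subseteq> Pow X" "D \<noteq> {}" for D
  proof -
    obtain E where "E \<in> D" "E \<subseteq> X"
      using \<open>D \<subseteq> Pow X\<close> \<open>D \<noteq> {}\<close> by auto
    then show ?thesis
      unfolding subset_expect_def using fin p by (intro sum_pos2[of _ E]) auto
  qed
  have secX: "sec F \<subseteq> Pow X" for F
    by (auto simp: sec_def)
  have secC: "sec F \<subseteq> C" if "F \<subseteq> Y" for F
    using that by (auto simp: C_def)
  have CX: "C \<subseteq> Pow X"
    using secX by (auto simp: C_def)
  have Cne: "C \<noteq> {}"
  proof -
    obtain E where E: "E \<in> A" using insert.prems by auto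
    then have "E \<subseteq> X \<union> Y" using insert.prems union by auto
    then have "(E \<inter> X) \<union> (E \<inter> Y) = E" by auto
    then have "E \<inter> X \<in> sec (E \<inter> Y)" using E by (auto simp: sec_def)
    then show ?thesis by (auto simp: C_def)
  qed
  \<comment> \<open>One distance function is fixed for every nonempty \<open>D\<close> at once,
    since the sections vary with \<open>F\<close>.\<close>
  define hs where "hs D = (SOME h :: 'a set \<Rightarrow> nat. ?near D h \<and>
      subset_expect p X (\<lambda>E. exp (t * h E)) * ?P D \<le> K)" for D
  have hs: "?near D (hs D)" "subset_expect p X (\<lambda>E. exp (t * hs D E)) * ?P D \<le> K"
    if "D \<subseteq> Pow X" "D \<noteq> {}" for D
    using someI_ex[OF IH[OF that]] unfolding hs_def by blast+
  \<comment> \<open>If the section is empty, keeping \<open>F\<close> cannot lead into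
    \<open>A\<close>, and only the change at cost 1 remains.\<close>
  define g where "g F E = (if sec F = {} then Suc (hs C E) else min (hs (sec F) E) (Suc (hs C E)))" for F E
  define h where "h E = g (E \<inter> Y) (E \<inter> X)" for E
  have hU: "h (E \<union> F) = g F E" if "E \<subseteq> X" "F \<subseteq> Y" for E F
  proof -
    have "(E \<union> F) \<inter> Y = F" "(E \<union> F) \<inter> X = E" using that XY by auto
    then show ?thesis by (simp add: h_def)
  qed
  have near: "\<exists>E'\<in>A. card {i\<in>insert j I. E \<inter> B i \<noteq> E' \<inter> B i} \<le> h E" if E: "E \<subseteq> X \<union> Y" for E
  proof -
    let ?F = "E \<inter> Y" and ?E = "E \<inter> X"
    have EF: "?E \<union> ?F = E" using E by auto
    have lift: "{i\<in>insert j I. E \<inter> B i \<noteq> (E' \<union> F') \<inter> B i}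
        = {i\<in>I. ?E \<inter> B i \<noteq> E' \<inter> B i} \<union> (if ?F = F' then {} else {j})"
      if "E' \<subseteq> X" "F' \<subseteq> Y" for E' F'
    proof -
      have same: "?E \<inter> B i = E \<inter> B i" "(E' \<union> F') \<inter> B i = E' \<inter> B i" if "i \<in> I" for i
        using BX[OF that] XY \<open>F' \<subseteq> Y\<close> by auto
      have "E \<inter> B j = ?F" "(E' \<union> F') \<inter> B j = F'"
        using that XY by (auto simp: Y_def)
      then have "i \<in> insert j I \<and> E \<inter> B i \<noteq> (E' \<union> F') \<inter> B i \<longleftrightarrow>
          i \<in> I \<and> ?E \<inter> B i \<noteq> E' \<inter> B i \<or> i = j \<and> ?F \<noteq> F'" for i
        using same[of i] insert.hyps(2) by (cases "i = j"; cases "i \<in> I") simp_all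
      then show ?thesis
        by (intro set_eqI) (simp only: mem_Collect_eq Un_iff, simp)
    qed
    have 1: "\<exists>E'\<in>A. card {i\<in>insert j I. E \<inter> B i \<noteq> E' \<inter> B i} \<le> hs (sec ?F) ?E" if ne: "sec ?F \<noteq> {}"
    proof -
      obtain E' where E': "E' \<in> sec ?F" "card {i\<in>I. ?E \<inter> B i \<noteq> E' \<inter> B i} \<le> hs (sec ?F) ?E"
        using hs(1)[OF secX ne, rule_format, OF Int_lower2] by blast
      then have E'A: "E' \<union> ?F \<in> A" and "E' \<subseteq> X" by (auto simp: sec_def)
      have "card {i\<in>insert j I. E \<inter> B i \<noteq> (E' \<union> ?F) \<inter> B i} \<le> hs (sec ?F) ?E"
        unfolding lift[OF \<open>E' \<subseteq> X\<close> Int_lower2] using E'(2) by simp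
      with E'A show ?thesis by blast
    qed
    have 2: "\<exists>E'\<in>A. card {i\<in>insert j I. E \<inter> B i \<noteq> E' \<inter> B i} \<le> Suc (hs C ?E)"
    proof -
      obtain E' where E': "E' \<in> C" "card {i\<in>I. ?E \<inter> B i \<noteq> E' \<inter> B i} \<le> hs C ?E"
        using hs(1)[OF CX Cne, rule_format, OF Int_lower2] by blast
      then obtain F' where F': "F' \<subseteq> Y" "E' \<union> F' \<in> A" "E' \<subseteq> X" by (auto simp: C_def sec_def)
      have "card ({i\<in>I. ?E \<inter> B i \<noteq> E' \<inter> B i} \<union> (if ?F = F' then {} else {j}))
          \<le> card {i\<in>I. ?E \<inter> B i \<noteq> E' \<inter> B i} + 1"
        by (rule order_trans[OF card_Un_le]) auto
      then have "card {i\<in>insert j I. E \<inter> B i \<noteq> (E' \<union> F') \<inter> B i} \<le> Suc (hs C ?E)"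
        unfolding lift[OF F'(3,1)] using E'(2) by linarith
      with F'(2) show ?thesis by blast
    qed
    show ?thesis
      unfolding h_def g_def min_def using 1 2 by simp
  qed
  \<comment> \<open>\<open>?u F\<close> is the probability of the section at \<open>F\<close>
    relative to that of the union \<open>C\<close>. By \<open>PA\<close> below, its mean
    \<open>?v\<close> is the probability of \<open>A\<close> divided by that of
    \<open>C\<close>.\<close>
  let ?u = "\<lambda>F. ?P (sec F) / ?P C"
  have PC: "?P C > 0" by (rule pos[OF CX Cne])
  have inner: "subset_expect p X (\<lambda>E. exp (t * g F E)) \<le> K / ?P C * (1 + exp t * (1 - ?u F))"
    if F: "F \<subseteq> Y" for F
  proof -
    have "subset_expect p X (\<lambda>E. exp (t * g F E)) \<le> subset_expect p X (\<lambda>E. exp t * exp (t * hs C E))"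
    proof (rule subset_expect_mono)
      fix E
      have "t * real (g F E) \<le> t * (1 + real (hs C E))"
        using t by (intro mult_left_mono) (auto simp: g_def)
      then show "exp (t * g F E) \<le> exp t * exp (t * hs C E)"
        by (simp add: exp_add[symmetric] algebra_simps)
    qed (use p in auto)
    also have "\<dots> \<le> exp t * (K / ?P C)"
      unfolding subset_expect_cmult using hs(2)[OF CX Cne] PC
      by (intro mult_left_mono) (auto simp: field_simps)
    finally have up: "subset_expect p X (\<lambda>E. exp (t * g F E)) \<le> K / ?P C * exp t"
      by (simp add: mult_ac)
    show ?thesis
    proof (cases "sec F = {}")
      case True
      then have u0: "?u F = 0" by (simp add: subset_expect_def)
      have "K / ?P C * exp t \<le> K / ?P C * (1 + exp t * (1 - ?u F))"
        unfolding u0 using PC by (intro mult_left_mono) (auto simp: K_def)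
      with up show ?thesis by linarith
    next
      case False
      have Ps: "?P (sec F) > 0" by (rule pos[OF secX False])
      have "?P (sec F) \<le> ?P C"
        using secC[OF F] p by (intro subset_expect_mono) auto
      then have u: "0 < ?u F" "?u F \<le> 1" using Ps PC by auto
      have "subset_expect p X (\<lambda>E. exp (t * g F E)) \<le> subset_expect p X (\<lambda>E. exp (t * hs (sec F) E))"
        using p t False by (intro subset_expect_mono) (auto simp: g_def intro!: mult_left_mono)
      also have "\<dots> \<le> K / ?P (sec F)"
        using hs(2)[OF secX False] Ps by (simp add: field_simps)
      also have "\<dots> = K / ?P C * (1 / ?u F)"
        using PC Ps by simp
      finally have "subset_expect p X (\<lambda>E. exp (t * g F E)) \<le> K / ?P C * min (1 / ?u F) (exp t)"
        using up by (auto simp: min_def)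
      also have "\<dots> \<le> K / ?P C * (1 + exp t * (1 - ?u F))"
        using min_inverse_exp_le[OF u t] PC by (intro mult_left_mono) (auto simp: K_def)
      finally show ?thesis .
    qed
  qed
  let ?v = "subset_expect p Y ?u"
  have Eh: "subset_expect p (X \<union> Y) (\<lambda>E. exp (t * h E)) \<le> K / ?P C * (1 + exp t * (1 - ?v))"
  proof -
    have "subset_expect p (X \<union> Y) (\<lambda>E. exp (t * h E))
        = subset_expect p Y (\<lambda>F. subset_expect p X (\<lambda>E. exp (t * h (F \<union> E))))"
      using subset_expect_Un[of Y X p] fin XY by (simp add: Un_commute Int_commute)
    also have "\<dots> = subset_expect p Y (\<lambda>F. subset_expect p X (\<lambda>E. exp (t * g F E)))"
      by (intro subset_expect_cong) (metis hU Un_commute)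
    also have "\<dots> \<le> subset_expect p Y (\<lambda>F. K / ?P C * (1 + exp t * (1 - ?u F)))"
      using p by (intro subset_expect_mono inner) auto
    also have "\<dots> = K / ?P C * (1 + exp t * (1 - ?v))"
      unfolding subset_expect_cmult subset_expect_add subset_expect_diff
        subset_expect_const[OF fin(2)] ..
    finally show ?thesis .
  qed
  have PA: "subset_expect p (X \<union> Y) (\<lambda>E. of_bool (E \<in> A)) = ?P C * ?v"
  proof -
    have "subset_expect p (X \<union> Y) (\<lambda>E. of_bool (E \<in> A))
        = subset_expect p Y (\<lambda>F. subset_expect p X (\<lambda>E. of_bool (F \<union> E \<in> A)))"
      using subset_expect_Un[of Y X p] fin XY by (simp add: Un_commute Int_commute)
    also have "\<dots> = subset_expect p Y (\<lambda>F. ?P C * ?u F)"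
    proof (rule subset_expect_cong)
      fix F
      have "subset_expect p X (\<lambda>E. of_bool (F \<union> E \<in> A)) = ?P (sec F)"
        by (rule subset_expect_cong) (auto simp: sec_def Un_commute)
      then show "subset_expect p X (\<lambda>E. of_bool (F \<union> E \<in> A)) = ?P C * ?u F"
        using PC by simp
    qed
    finally show ?thesis unfolding subset_expect_cmult .
  qed
  have v0: "?v \<ge> 0"
    unfolding subset_expect_def using p by (intro sum_nonneg mult_nonneg_nonneg divide_nonneg_nonneg) auto
  \<comment> \<open>The left side is a quadratic in \<open>?v\<close> with maximum at (1 + e) / (2
    e) for e = \<open>exp t\<close>, whence the square below.\<close>
  have quad: "(1 + exp t * (1 - ?v)) * ?v \<le> (1 + exp t)\<^sup>2 / (4 * exp t)"
  proof -
    have "0 \<le> (1 + e - 2 * e * v)\<^sup>2" for e v :: real by simp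
    then have "(1 + e * (1 - v)) * v * (4 * e) \<le> (1 + e)\<^sup>2" for e v :: real
      by (simp add: power2_eq_square algebra_simps)
    from this[of "exp t" ?v] show ?thesis
      by (subst pos_le_divide_eq) (simp, assumption)
  qed
  have "subset_expect p (X \<union> Y) (\<lambda>E. exp (t * h E)) * subset_expect p (X \<union> Y) (\<lambda>E. of_bool (E \<in> A))
      \<le> K / ?P C * (1 + exp t * (1 - ?v)) * (?P C * ?v)"
    unfolding PA using PC v0 by (intro mult_right_mono Eh) auto
  also have "\<dots> = K * ((1 + exp t * (1 - ?v)) * ?v)"
    using PC by simp
  also have "\<dots> \<le> K * exp (t\<^sup>2 / 4)"
    using quad cosh_half_squared_le[OF t] by (intro mult_left_mono) (auto simp: K_def)
  also have "\<dots> = exp (card (insert j I) * t\<^sup>2 / 4)"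
    using insert.hyps by (simp add: K_def exp_add[symmetric] algebra_simps add_divide_distrib)
  finally show ?case
    unfolding union by (intro exI[of _ h] conjI allI impI near)
qed

section \<open>Counting independent sets\<close>

lemma power_self_le_fact_exp: "real l ^ l \<le> fact l * exp (real l)"
proof -
  \<comment> \<open>The \<open>l\<close>-th term of the exponential series at \<open>l\<close> is at
    most the whole sum.\<close>
  have "real l ^ l /\<^sub>R fact l \<le> (\<Sum>n. real l ^ n /\<^sub>R fact n)"
    by (rule order_trans[OF _ sum_le_suminf[of _ "{l}"]]) (auto intro: summable_exp)
  then show ?thesis
    by (simp add: exp_def field_simps)
qed

lemma binomial_le_power_exp: "real (n choose l) \<le> (exp 1 * n / l) ^ l"
proof (cases "l = 0")
  case False
  have "real (n choose l) * fact l \<le> real n ^ l"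
    using binomial_fact_pow[of n l] by (metis of_nat_fact of_nat_le_iff of_nat_mult of_nat_power)
  then have "real (n choose l) * (fact l * exp (real l)) \<le> real n ^ l * exp (real l)"
    by (simp add: mult.assoc[symmetric])
  moreover have "real (n choose l) * real l ^ l \<le> real (n choose l) * (fact l * exp (real l))"
    by (intro mult_left_mono power_self_le_fact_exp) auto
  moreover have "exp (real l) = exp 1 ^ l"
    by (simp add: exp_of_nat_mult[symmetric])
  ultimately have "real (n choose l) * real l ^ l \<le> real n ^ l * exp 1 ^ l"
    by (metis order_trans)
  then show ?thesis
    using False by (simp add: field_simps power_mult_distrib power_divide)
qed simp

text \<open>The quotient of the two coefficients is the product of (k - i) / (n - i) over i < l, and
  each factor is at most k / n. It is the probability that a random \<open>k\<close>-subset contains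
  \<open>l\<close> given points.\<close>

lemma binomial_shift_le:
  assumes "l \<le> k" "k \<le> n" "n > 0"
  shows "real ((n - l) choose (k - l)) \<le> real (n choose k) * (real k / real n) ^ l"
  using assms(1)
proof (induction l)
  case (Suc l)
  have "(n - l) * ((n - Suc l) choose (k - Suc l)) = (k - l) * ((n - l) choose (k - l))"
    using binomial_absorption[of "k - Suc l" "n - l"] Suc.prems assms(2)
    by (simp add: Suc_diff_Suc mult.commute)
  then have "real (n - l) * ((n - Suc l) choose (k - Suc l)) = real (k - l) * ((n - l) choose (k - l))"
    by (metis of_nat_mult)
  then have "real ((n - Suc l) choose (k - Suc l)) = real (k - l) / real (n - l) * ((n - l) choose (k - l))"
    using Suc.prems assms(2) by (simp add: field_simps)
  also have "\<dots> \<le> real k / real n * (real (n choose k) * (real k / real n) ^ l)"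
  proof (intro mult_mono)
    show "real (k - l) / real (n - l) \<le> real k / real n"
      using Suc.prems assms(2) mult_left_mono[of "real k" "real n" "real l"]
      by (simp add: field_simps of_nat_diff)
  qed (use Suc in auto)
  finally show ?case by (simp add: mult_ac)
qed simp

lemma card_subsets_meeting:
  assumes "finite V" "\<sigma> \<subseteq> V"
  shows "card {\<tau>. \<tau> \<subseteq> V \<and> card (\<tau> \<inter> \<sigma>) = a \<and> card (\<tau> - \<sigma>) = b}
    = (card \<sigma> choose a) * ((card V - card \<sigma>) choose b)"
proof -
  have fin: "finite \<sigma>" "finite (V - \<sigma>)"
    using assms finite_subset by auto
  have "bij_betw (\<lambda>\<tau>. (\<tau> \<inter> \<sigma>, \<tau> - \<sigma>))
      {\<tau>. \<tau> \<subseteq> V \<and> card (\<tau> \<inter> \<sigma>) = a \<and> card (\<tau> - \<sigma>) = b}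
      ({A. A \<subseteq> \<sigma> \<and> card A = a} \<times> {B. B \<subseteq> V - \<sigma> \<and> card B = b})"
  proof (rule bij_betw_byWitness[where f' = "\<lambda>(A, B). A \<union> B"], goal_cases)
    case 4
    have "(A \<union> B) \<inter> \<sigma> = A" "A \<union> B - \<sigma> = B" if "A \<subseteq> \<sigma>" "B \<subseteq> V - \<sigma>" for A B
      using that by auto
    then show ?case using assms by auto
  qed (use assms in auto)
  then have "card {\<tau>. \<tau> \<subseteq> V \<and> card (\<tau> \<inter> \<sigma>) = a \<and> card (\<tau> - \<sigma>) = b}
      = (card \<sigma> choose a) * (card (V - \<sigma>) choose b)"
    using fin by (simp add: bij_betw_same_card card_cartesian_product n_subsets)
  then show ?thesis
    using assms fin by (simp add: card_Diff_subset)
qed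

section \<open>Pairs inside vertex sets and moments of the number of independent sets\<close>

definition edges_within :: "'a set \<Rightarrow> 'a set set" where
  "edges_within S = {e. e \<subseteq> S \<and> card e = 2}"

lemma finite_edges_within: "finite S \<Longrightarrow> finite (edges_within S)"
  by (simp add: edges_within_def)

lemma card_edges_within: "finite S \<Longrightarrow> card (edges_within S) = card S choose 2"
  by (simp add: edges_within_def n_subsets)

lemma all_edges_eq: "all_edges n = edges_within {1..n}"
  by (simp add: all_edges_def edges_within_def)

lemma finite_all_edges: "finite (all_edges n)"
  by (simp add: all_edges_eq finite_edges_within)

lemma card_all_edges: "card (all_edges n) = n choose 2"
  by (simp add: all_edges_eq card_edges_within)

lemma is_indep_iff:
  assumes "E \<subseteq> all_edges n"
  shows "is_indep n E S \<longleftrightarrow> S \<subseteq> {1..n} \<and> E \<inter> edges_within S = {}"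
  using assms unfolding is_indep_def all_edges_def edges_within_def by blast

text \<open>Inclusion-exclusion, in additive form to avoid truncated subtraction: a pair lies within
  both sets iff it lies within their intersection.\<close>

lemma card_edges_within_Un:
  assumes "finite S" "finite T"
  shows "card (edges_within S \<union> edges_within T) + (card (S \<inter> T) choose 2)
    = (card S choose 2) + (card T choose 2)"
proof -
  have "edges_within S \<inter> edges_within T = edges_within (S \<inter> T)"
    by (auto simp: edges_within_def)
  then show ?thesis
    using card_Un_Int[OF finite_edges_within[OF assms(1)] finite_edges_within[OF assms(2)]] assms
    by (simp add: card_edges_within)
qed

text \<open>Both sets are independent exactly when the graph avoids all pairs inside one of them.
  The case \<open>S = T\<close> gives the probability for a single set.\<close>

lemma expect_indep_pair:
  assumes "S \<subseteq> {1..n}" "T \<subseteq> {1..n}"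
  shows "subset_expect p (all_edges n) (\<lambda>E. of_bool (is_indep n E S \<and> is_indep n E T))
    = (1 - p) ^ card (edges_within S \<union> edges_within T)"
proof -
  have "subset_expect p (all_edges n) (\<lambda>E. of_bool (is_indep n E S \<and> is_indep n E T))
      = subset_expect p (all_edges n) (\<lambda>E. of_bool (E \<inter> (edges_within S \<union> edges_within T) = {}))"
    by (rule subset_expect_cong) (use assms in \<open>auto simp: is_indep_iff\<close>)
  also have "\<dots> = (1 - p) ^ card (edges_within S \<union> edges_within T)"
    by (rule subset_expect_avoid[OF finite_all_edges])
      (use assms in \<open>auto simp: all_edges_eq edges_within_def\<close>)
  finally show ?thesis .
qed

definition vertex_subsets :: "nat \<Rightarrow> nat \<Rightarrow> nat set set" where
  "vertex_subsets n k = {S. S \<subseteq> {1..n} \<and> card S = k}"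

lemma finite_vertex_subsets: "finite (vertex_subsets n k)"
  unfolding vertex_subsets_def by (rule finite_subset[of _ "Pow {1..n}"]) auto

lemma card_vertex_subsets: "card (vertex_subsets n k) = n choose k"
  by (simp add: vertex_subsets_def n_subsets)

lemma indep_sets_eq: "indep_sets n E k = {S \<in> vertex_subsets n k. is_indep n E S}"
  by (auto simp: indep_sets_def vertex_subsets_def is_indep_def)

lemma finite_indep_sets: "finite (indep_sets n E k)"
  by (simp add: indep_sets_eq finite_vertex_subsets)

lemma card_indep_sets: "real (card (indep_sets n E k)) = (\<Sum>S\<in>vertex_subsets n k. of_bool (is_indep n E S))"
  by (simp add: indep_sets_eq finite_vertex_subsets sum.If_cases of_bool_def Int_def)

abbreviation expect_indep :: "real \<Rightarrow> nat \<Rightarrow> nat \<Rightarrow> real" where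
  "expect_indep p n k \<equiv> subset_expect p (all_edges n) (\<lambda>E. real (card (indep_sets n E k)))"

lemma expect_indep_eq: "expect_indep p n k = real (n choose k) * (1 - p) ^ (k choose 2)"
proof -
  have "expect_indep p n k = (\<Sum>S\<in>vertex_subsets n k.
      subset_expect p (all_edges n) (\<lambda>E. of_bool (is_indep n E S)))"
    unfolding card_indep_sets by (rule subset_expect_sum)
  also have "\<dots> = (\<Sum>S\<in>vertex_subsets n k. (1 - p) ^ (k choose 2))"
  proof (intro sum.cong refl)
    fix S assume "S \<in> vertex_subsets n k"
    then show "subset_expect p (all_edges n) (\<lambda>E. of_bool (is_indep n E S)) = (1 - p) ^ (k choose 2)"
      using expect_indep_pair[of S n S p] finite_subset[of S "{1..n}"]
      by (simp add: vertex_subsets_def card_edges_within)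
  qed
  finally show ?thesis by (simp add: card_vertex_subsets)
qed

text \<open>Pairs \<open>(S, T)\<close> are grouped by the size \<open>l\<close> of their overlap.
  They share \<open>l choose 2\<close> vertex pairs, so their joint probability exceeds the product
  by the factor \<open>1 / (1 - p) ^ (l choose 2)\<close>, which the hypothesis on \<open>M\<close>
  cancels. There are \<open>k + 1\<close> values of \<open>l\<close>.\<close>

lemma second_moment_le:
  fixes p M :: real
  assumes p: "0 \<le> p" "p < 1"
    and M: "\<And>l. l \<le> k \<Longrightarrow>
      real ((k choose l) * ((n - k) choose (k - l))) \<le> M * (n choose k) * (1 - p) ^ (l choose 2)"
  shows "subset_expect p (all_edges n) (\<lambda>E. (real (card (indep_sets n E k)))\<^sup>2)
    \<le> real (k + 1) * M * (expect_indep p n k)\<^sup>2"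
proof -
  let ?V = "vertex_subsets n k" and ?q = "1 - p" and ?K = "k choose 2"
  have q: "?q > 0" "?q \<le> 1" using p by auto
  have one: "(\<Sum>T\<in>?V. ?q ^ card (edges_within S \<union> edges_within T))
      \<le> real (k + 1) * (M * (n choose k) * ?q ^ (2 * ?K))" if S: "S \<in> ?V" for S
  proof -
    have fS: "finite S" "S \<subseteq> {1..n}" "card S = k"
      using S by (auto simp: vertex_subsets_def intro: finite_subset)
    have "(\<Sum>T\<in>?V. ?q ^ card (edges_within S \<union> edges_within T))
        = (\<Sum>l\<le>k. \<Sum>T | T \<in> ?V \<and> card (T \<inter> S) = l. ?q ^ card (edges_within S \<union> edges_within T))"
      using fS by (intro sum.group[symmetric] finite_vertex_subsets) (auto intro: card_mono)
    also have "\<dots> \<le> (\<Sum>l\<le>k. M * (n choose k) * ?q ^ (2 * ?K))"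
    proof (rule sum_mono)
      fix l assume "l \<in> {..k}"
      then have l: "l \<le> k" by simp
      have sub: "{T. T \<in> ?V \<and> card (T \<inter> S) = l}
          \<subseteq> {T. T \<subseteq> {1..n} \<and> card (T \<inter> S) = l \<and> card (T - S) = k - l}" 
        using fS by (auto simp: vertex_subsets_def card_Diff_subset_Int finite_subset)
      have "(\<Sum>T | T \<in> ?V \<and> card (T \<inter> S) = l. ?q ^ card (edges_within S \<union> edges_within T))
          = (\<Sum>T | T \<in> ?V \<and> card (T \<inter> S) = l. ?q ^ (2 * ?K) / ?q ^ (l choose 2))"
      proof (rule sum.cong[OF refl])
        fix T assume T: "T \<in> {T. T \<in> ?V \<and> card (T \<inter> S) = l}"
        then have "finite T" by (auto simp: vertex_subsets_def intro: finite_subset)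
        then have "card (edges_within S \<union> edges_within T) + (l choose 2) = 2 * ?K"
          using card_edges_within_Un[of S T] fS T by (auto simp: vertex_subsets_def Int_commute)
        then show "?q ^ card (edges_within S \<union> edges_within T) = ?q ^ (2 * ?K) / ?q ^ (l choose 2)"
          using q by (metis nonzero_eq_divide_eq less_numeral_extra(3) power_add power_not_zero)
      qed
      also have "\<dots> = real (card {T. T \<in> ?V \<and> card (T \<inter> S) = l}) * (?q ^ (2 * ?K) / ?q ^ (l choose 2))"
        by simp
      also have "\<dots> \<le> real ((k choose l) * ((n - k) choose (k - l))) * (?q ^ (2 * ?K) / ?q ^ (l choose 2))"
        using card_mono[OF _ sub] card_subsets_meeting[of "{1..n}" S l "k - l"] fS q
        by (intro mult_right_mono) (auto simp: of_nat_mult[symmetric] simp del: of_nat_mult)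
      also have "\<dots> \<le> M * (n choose k) * ?q ^ (l choose 2) * (?q ^ (2 * ?K) / ?q ^ (l choose 2))"
        using M[OF l] q by (intro mult_right_mono) auto
      also have "\<dots> = M * (n choose k) * ?q ^ (2 * ?K)"
        using q by simp
      finally show "(\<Sum>T | T \<in> ?V \<and> card (T \<inter> S) = l. ?q ^ card (edges_within S \<union> edges_within T))
          \<le> M * (n choose k) * ?q ^ (2 * ?K)" .
    qed
    finally show ?thesis by simp
  qed
  have "subset_expect p (all_edges n) (\<lambda>E. (real (card (indep_sets n E k)))\<^sup>2)
      = subset_expect p (all_edges n) (\<lambda>E. \<Sum>S\<in>?V. \<Sum>T\<in>?V. of_bool (is_indep n E S \<and> is_indep n E T))"
    by (intro subset_expect_cong)
      (simp only: card_indep_sets power2_eq_square sum_product of_bool_conj)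
  also have "\<dots> = (\<Sum>S\<in>?V. \<Sum>T\<in>?V. ?q ^ card (edges_within S \<union> edges_within T))"
    unfolding subset_expect_sum
    by (intro sum.cong refl expect_indep_pair) (auto simp: vertex_subsets_def)
  also have "\<dots> \<le> (\<Sum>S\<in>?V. real (k + 1) * (M * (n choose k) * ?q ^ (2 * ?K)))"
    by (intro sum_mono one)
  also have "\<dots> = real (k + 1) * M * (expect_indep p n k)\<^sup>2"
    by (simp add: expect_indep_eq card_vertex_subsets power2_eq_square power_mult[symmetric]
        power_add[symmetric] mult_2 algebra_simps)
  finally show ?thesis .
qed

section \<open>Lower tail, pairs and transfer to the uniform model\<close>

text \<open>If \<open>E\<close> and \<open>E'\<close> differ only in edges with larger end point in \<open>W\<close>, then deleting \<open>W\<close> from an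
  \<open>E'\<close>-independent set of size \<open>k + w\<close> leaves an \<open>E\<close>-independent set with at least \<open>k\<close> elements.\<close>

lemma card_indep_sets_perturb:
  assumes E: "E \<subseteq> all_edges n" "E' \<subseteq> all_edges n"
    and W: "card W \<le> w" "W \<subseteq> {1..n}" "\<And>e. e \<in> all_edges n \<Longrightarrow> Max e \<notin> W \<Longrightarrow> e \<in> E \<longleftrightarrow> e \<in> E'"
  shows "card (indep_sets n E' (k + w)) \<le> card (indep_sets n E k) * (n choose w)"
proof -
  \<comment> \<open>Each large set is a \<open>k\<close>-subset \<open>T\<close> avoiding
    \<open>W\<close> together with \<open>w\<close> further vertices, so every \<open>T\<close>
    accounts for at most \<open>n choose w\<close> large sets.\<close>
  have sub: "indep_sets n E' (k + w)
      \<subseteq> (\<Union>T\<in>indep_sets n E k. (\<lambda>R. T \<union> R) ` vertex_subsets n w)"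
  proof
    fix S assume "S \<in> indep_sets n E' (k + w)"
    then have S: "is_indep n E' S" "S \<subseteq> {1..n}" "card S = k + w"
      by (auto simp: indep_sets_def is_indep_def)
    then have fS: "finite S" by (auto intro: finite_subset)
    have fW: "finite W" using W(2) finite_subset by blast
    have "k \<le> card (S - W)"
      using diff_card_le_card_Diff[OF fW, of S] S(3) W(1) by linarith
    then obtain T where T: "T \<subseteq> S - W" "card T = k"
      using obtain_subset_with_card_n by metis
    have "is_indep n E T"
      unfolding is_indep_def
    proof (intro conjI ballI notI)
      fix e assume e: "e \<in> E" "e \<subseteq> T"
      then have e': "e \<in> all_edges n" using E by auto
      then have "finite e" "e \<noteq> {}"
        by (auto simp: all_edges_def intro: finite_subset)
      then have "Max e \<notin> W"
        using Max_in e(2) T(1) by blast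
      then have "e \<in> E'" using W(3) e' e(1) by blast
      then show False
        using S(1) e(2) T(1) unfolding is_indep_def by blast
    qed (use T S in auto)
    then have "T \<in> indep_sets n E k" using T by (simp add: indep_sets_def)
    moreover have "S - T \<in> vertex_subsets n w"
    proof -
      have "T \<subseteq> S" "finite T" using T fS by (auto intro: finite_subset)
      then show ?thesis
        using T(2) S by (auto simp: vertex_subsets_def card_Diff_subset)
    qed
    moreover have "S = T \<union> (S - T)" using T by auto
    ultimately show "S \<in> (\<Union>T\<in>indep_sets n E k. (\<lambda>R. T \<union> R) ` vertex_subsets n w)"
      by blast
  qed
  have "card (indep_sets n E' (k + w)) \<le> card (\<Union>T\<in>indep_sets n E k. (\<lambda>R. T \<union> R) ` vertex_subsets n w)"
    by (rule card_mono[OF _ sub]) (simp add: finite_indep_sets finite_vertex_subsets)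
  also have "\<dots> \<le> (\<Sum>T\<in>indep_sets n E k. card ((\<lambda>R. T \<union> R) ` vertex_subsets n w))"
    by (rule card_UN_le[OF finite_indep_sets])
  also have "\<dots> \<le> (\<Sum>T\<in>indep_sets n E k. n choose w)"
    by (intro sum_mono order_trans[OF card_image_le[OF finite_vertex_subsets]])
      (simp add: card_vertex_subsets)
  finally show ?thesis by simp
qed

text \<open>The second moment only gives the lower bound \<open>1 / (4 (k + w + 1) M)\<close>, exponentially small in
  the application, on the probability of having many independent sets of size \<open>k + w\<close>. Giving up
  \<open>w\<close> vertices boosts this to a probability close to 1.\<close>

lemma card_indep_sets_lower_tail:
  fixes p t M :: real and n k w :: nat
  assumes p: "0 < p" "p < 1" and t: "t \<ge> 0" and kw: "k + w \<le> n"
    and M: "\<And>l. l \<le> k + w \<Longrightarrow> real ((k + w choose l) * ((n - (k + w)) choose (k + w - l)))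
      \<le> M * (n choose (k + w)) * (1 - p) ^ (l choose 2)"
  shows "subset_expect p (all_edges n) (\<lambda>E. of_bool (real (card (indep_sets n E k))
      < expect_indep p n (k + w) / (2 * real (n choose w))))
    \<le> 4 * (real k + real w + 1) * M * exp (n * t\<^sup>2 / 4 - t * w)"
proof -
  let ?X = "all_edges n" and ?Z = "\<lambda>k E. real (card (indep_sets n E k))"
  let ?E = "subset_expect p (all_edges n)"
  define \<mu> where "\<mu> = expect_indep p n (k + w)"
  define A where "A = {E. E \<subseteq> ?X \<and> \<mu> / 2 \<le> ?Z (k + w) E}"
  define PA where "PA = ?E (\<lambda>E. of_bool (E \<in> A))"
  \<comment> \<open>Assigning every edge to its larger end point partitions the edges into
    \<open>n\<close> blocks, so the Hamming distance counts vertices whose block changes.\<close>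
  define B where "B v = {e \<in> ?X. Max e = v}" for v
  have \<mu>: "\<mu> > 0"
    using p kw by (simp add: \<mu>_def expect_indep_eq)
  have PA0: "PA \<ge> 0"
    unfolding PA_def subset_expect_def using p by (intro sum_nonneg) auto
  have "\<mu>\<^sup>2 \<le> 4 * ?E (\<lambda>E. (?Z (k + w) E)\<^sup>2) * ?E (\<lambda>E. of_bool (\<mu> / 2 \<le> ?Z (k + w) E))"
    unfolding \<mu>_def by (rule Paley_Zygmund_half) (use p finite_all_edges in auto)
  also have "?E (\<lambda>E. of_bool (\<mu> / 2 \<le> ?Z (k + w) E)) = PA"
    unfolding PA_def by (rule subset_expect_cong) (simp add: A_def)
  also have "4 * ?E (\<lambda>E. (?Z (k + w) E)\<^sup>2) * PA \<le> 4 * (real (k + w + 1) * M * \<mu>\<^sup>2) * PA"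
    unfolding \<mu>_def using second_moment_le[of p "k + w" n M] p M PA0
    by (intro mult_right_mono mult_left_mono) auto
  finally have "1 * \<mu>\<^sup>2 \<le> (4 * (k + w + 1) * M * PA) * \<mu>\<^sup>2"
    by (simp add: algebra_simps)
  then have PA1: "1 \<le> 4 * (k + w + 1) * M * PA"
    using \<mu> by (simp only: mult_le_cancel_right_pos zero_less_power)
  then have "PA \<noteq> 0" by auto
  with PA0 have PA: "PA > 0" by simp
  then have "A \<noteq> {}"
    by (auto simp: PA_def subset_expect_def)
  moreover have "A \<subseteq> Pow ?X"
    by (auto simp: A_def)
  ultimately have A: "A \<noteq> {}" "A \<subseteq> Pow ?X" .
  have UB: "(\<Union>v\<in>{1..n}. B v) = ?X"
  proof -
    have "Max e \<in> {1..n}" if "e \<in> ?X" for e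
    proof -
      have "e \<subseteq> {1..n}" "card e = 2" using that by (auto simp: all_edges_def)
      then have "finite e" "e \<noteq> {}" by (auto intro: finite_subset)
      then show ?thesis using Max_in \<open>e \<subseteq> {1..n}\<close> by blast
    qed
    then show ?thesis by (auto simp: B_def)
  qed
  have "disjoint_family_on B {1..n}"
    by (auto simp: disjoint_family_on_def B_def)
  moreover have "finite (B v)" for v
    by (simp add: B_def finite_all_edges)
  ultimately obtain h :: "nat set set \<Rightarrow> nat" where
    h: "\<And>E. E \<subseteq> ?X \<Longrightarrow> \<exists>E'\<in>A. card {v\<in>{1..n}. E \<inter> B v \<noteq> E' \<inter> B v} \<le> h E"
    and Eh: "?E (\<lambda>E. exp (t * h E)) * PA \<le> exp (n * t\<^sup>2 / 4)"
    using hamming_blow_up[of "{1..n}" B p t A] p t A unfolding UB PA_def by auto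
  \<comment> \<open>Exponential Markov inequality: too few independent sets of size \<open>k\<close>
    force \<open>h E\<close> to be at least \<open>w\<close>, because a graph of \<open>A\<close> at
    distance at most \<open>w\<close> would supply enough.\<close>
  have "?E (\<lambda>E. of_bool (?Z k E < \<mu> / (2 * real (n choose w)))) \<le> ?E (\<lambda>E. exp (- (t * w)) * exp (t * h E))"
  proof (rule subset_expect_mono)
    fix E assume EX: "E \<subseteq> ?X"
    have "w \<le> h E" if low: "?Z k E < \<mu> / (2 * real (n choose w))"
    proof (rule ccontr)
      assume "\<not> w \<le> h E"
      then obtain E' where E': "E' \<in> A" "card {v\<in>{1..n}. E \<inter> B v \<noteq> E' \<inter> B v} \<le> w"
        using h[OF EX] by fastforce
      have "card (indep_sets n E' (k + w)) \<le> card (indep_sets n E k) * (n choose w)"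
      proof (rule card_indep_sets_perturb[OF EX _ E'(2)])
        fix e assume e: "e \<in> ?X" "Max e \<notin> {v \<in> {1..n}. E \<inter> B v \<noteq> E' \<inter> B v}"
        then obtain v where "v \<in> {1..n}" "e \<in> B v" using UB by blast
        then show "e \<in> E \<longleftrightarrow> e \<in> E'" using e by (auto simp: B_def)
      qed (use E' A in auto)
      then have "?Z (k + w) E' \<le> ?Z k E * (n choose w)"
        by (metis of_nat_le_iff of_nat_mult)
      moreover have "\<mu> / 2 \<le> ?Z (k + w) E'" using E' by (simp add: A_def)
      ultimately have "\<mu> / 2 \<le> ?Z k E * (n choose w)" by linarith
      moreover have "real (n choose w) > 0" using kw by simp
      ultimately show False using low by (simp add: field_simps)
    qed
    then show "of_bool (?Z k E < \<mu> / (2 * real (n choose w))) \<le> exp (- (t * w)) * exp (t * h E)"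
      using t by (auto simp: exp_add[symmetric] mult_left_mono)
  qed (use p in auto)
  also have "\<dots> = exp (- (t * w)) * ?E (\<lambda>E. exp (t * h E))"
    by (rule subset_expect_cmult)
  also have "\<dots> \<le> exp (- (t * w)) * (exp (n * t\<^sup>2 / 4) * (4 * (k + w + 1) * M))"
  proof (rule mult_left_mono)
    have "?E (\<lambda>E. exp (t * h E)) \<ge> 0"
      unfolding subset_expect_def using p by (intro sum_nonneg) auto
    \<comment> \<open>The factor from \<open>PA1\<close> is at least 1 and brings in
      \<open>PA\<close>, so that \<open>Eh\<close> applies.\<close>
    then have "?E (\<lambda>E. exp (t * h E)) * 1 \<le> ?E (\<lambda>E. exp (t * h E)) * (4 * (k + w + 1) * M * PA)"
      using PA1 by (intro mult_left_mono)
    also have "\<dots> = (?E (\<lambda>E. exp (t * h E)) * PA) * (4 * (k + w + 1) * M)"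
      by (simp add: mult_ac)
    also have "\<dots> \<le> exp (n * t\<^sup>2 / 4) * (4 * (k + w + 1) * M)"
    proof (rule mult_right_mono[OF Eh])
      show "0 \<le> 4 * (k + w + 1) * M"
        using PA1 PA by (smt (verit) zero_less_mult_iff)
    qed
    finally show "?E (\<lambda>E. exp (t * h E)) \<le> exp (n * t\<^sup>2 / 4) * (4 * (k + w + 1) * M)" by simp
  qed simp
  also have "\<dots> = 4 * (k + w + 1) * M * (exp (- (t * w)) * exp (n * t\<^sup>2 / 4))"
    by (simp only: mult_ac)
  also have "exp (- (t * w)) * exp (n * t\<^sup>2 / 4) = exp (n * t\<^sup>2 / 4 - t * w)"
    by (simp add: exp_add[symmetric])
  finally show ?thesis
    unfolding \<mu>_def by (simp add: add_ac)
qed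

section \<open>First moment of pairs with prescribed overlap\<close>

lemma add_choose_2: "(a + b) choose 2 = (a choose 2) + (b choose 2) + a * b"
  by (induction b) (auto simp: numeral_2_eq_2)

text \<open>Union bound over \<open>T\<close>, grouped by a = \<open>card (T \<inter> S)\<close> and
  b = \<open>card (T - S)\<close>. Beyond the pairs inside \<open>S\<close>, independence of
  \<open>T\<close> excludes the \<open>a * b\<close> pairs between old and new vertices and the
  \<open>b choose 2\<close> pairs of new ones.\<close>

lemma expect_overlapping_pairs_le:
  fixes p :: real
  assumes p: "0 \<le> p" "p \<le> 1" and D: "finite D"
  shows "subset_expect p (all_edges n) (\<lambda>E. real (card {S \<in> indep_sets n E k.
      \<exists>T. is_indep n E T \<and> (card (T \<inter> S), card (T - S)) \<in> D}))
    \<le> expect_indep p n k * (\<Sum>(a, b)\<in>D. real (k choose a) * real (n choose b) * (1 - p) ^ (a * b + (b choose 2)))"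
proof -
  let ?V = "vertex_subsets n k" and ?q = "1 - p"
  define R where "R S = {T. T \<subseteq> {1..n} \<and> (card (T \<inter> S), card (T - S)) \<in> D}" for S :: "nat set"
  have fR: "finite (R S)" for S
    unfolding R_def by (rule finite_subset[of _ "Pow {1..n}"]) auto
  have "real (card {S \<in> indep_sets n E k. \<exists>T. is_indep n E T \<and> (card (T \<inter> S), card (T - S)) \<in> D})
      \<le> (\<Sum>S\<in>?V. \<Sum>T\<in>R S. of_bool (is_indep n E S \<and> is_indep n E T))" for E
  proof -
    have "real (card {S \<in> indep_sets n E k. \<exists>T. is_indep n E T \<and> (card (T \<inter> S), card (T - S)) \<in> D})
        = (\<Sum>S\<in>?V. of_bool (is_indep n E S \<and> (\<exists>T. is_indep n E T \<and> (card (T \<inter> S), card (T - S)) \<in> D)))"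
      by (simp add: indep_sets_eq finite_vertex_subsets of_bool_def sum.If_cases Int_def conj_assoc)
    also have "\<dots> \<le> (\<Sum>S\<in>?V. \<Sum>T\<in>R S. of_bool (is_indep n E S \<and> is_indep n E T))"
    proof (rule sum_mono)
      fix S
      show "of_bool (is_indep n E S \<and> (\<exists>T. is_indep n E T \<and> (card (T \<inter> S), card (T - S)) \<in> D))
          \<le> (\<Sum>T\<in>R S. of_bool (is_indep n E S \<and> is_indep n E T) :: real)"
      proof (cases "is_indep n E S \<and> (\<exists>T. is_indep n E T \<and> (card (T \<inter> S), card (T - S)) \<in> D)")
        case True
        then obtain T where T: "is_indep n E S" "is_indep n E T" "(card (T \<inter> S), card (T - S)) \<in> D"
          by auto
        then have "T \<in> R S" by (auto simp: R_def is_indep_def)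
        then have "of_bool (is_indep n E S \<and> is_indep n E T) \<le>
            (\<Sum>T\<in>R S. of_bool (is_indep n E S \<and> is_indep n E T) :: real)"
          by (intro member_le_sum fR) auto
        then show ?thesis using T True by simp
      qed (auto intro: sum_nonneg)
    qed
    finally show ?thesis .
  qed
  then have "subset_expect p (all_edges n) (\<lambda>E. real (card {S \<in> indep_sets n E k.
        \<exists>T. is_indep n E T \<and> (card (T \<inter> S), card (T - S)) \<in> D}))
      \<le> subset_expect p (all_edges n) (\<lambda>E. \<Sum>S\<in>?V. \<Sum>T\<in>R S. of_bool (is_indep n E S \<and> is_indep n E T))"
    using p by (intro subset_expect_mono)
  also have "\<dots> = (\<Sum>S\<in>?V. \<Sum>T\<in>R S. ?q ^ card (edges_within S \<union> edges_within T))"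
    unfolding subset_expect_sum
    by (intro sum.cong refl expect_indep_pair) (auto simp: vertex_subsets_def R_def)
  also have "\<dots> \<le> (\<Sum>S\<in>?V. ?q ^ (k choose 2) *
      (\<Sum>(a, b)\<in>D. real (k choose a) * real (n choose b) * ?q ^ (a * b + (b choose 2))))"
  proof (rule sum_mono)
    fix S assume S: "S \<in> ?V"
    then have fS: "finite S" "S \<subseteq> {1..n}" "card S = k"
      by (auto simp: vertex_subsets_def intro: finite_subset)
    have "(\<Sum>T\<in>R S. ?q ^ card (edges_within S \<union> edges_within T))
        = (\<Sum>ab\<in>D. \<Sum>T | T \<in> R S \<and> (card (T \<inter> S), card (T - S)) = ab.
            ?q ^ card (edges_within S \<union> edges_within T))"
      by (intro sum.group[symmetric] fR D) (auto simp: R_def)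
    also have "\<dots> \<le> (\<Sum>ab\<in>D. ?q ^ (k choose 2) *
        (real (k choose fst ab) * real (n choose snd ab) * ?q ^ (fst ab * snd ab + (snd ab choose 2))))"
    proof (rule sum_mono)
      fix ab assume "ab \<in> D"
      obtain a b where ab: "ab = (a, b)" by force
      let ?R = "{T. T \<in> R S \<and> (card (T \<inter> S), card (T - S)) = ab}"
      have "(\<Sum>T\<in>?R. ?q ^ card (edges_within S \<union> edges_within T))
          = (\<Sum>T\<in>?R. ?q ^ ((k choose 2) + (a * b + (b choose 2))))"
      proof (rule sum.cong[OF refl])
        fix T assume T: "T \<in> ?R"
        then have fT: "finite T" by (auto simp: R_def intro: finite_subset)
        then have "card T = card (T \<inter> S) + card (T - S)"
          by (metis Int_Diff_disjoint Int_Diff_Un card_Un_disjoint finite_Diff finite_Int)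
        then have "card T = a + b" "card (S \<inter> T) = a"
          using T by (auto simp: ab Int_commute)
        then have "card (edges_within S \<union> edges_within T) = (k choose 2) + (a * b + (b choose 2))"
          using card_edges_within_Un[OF fS(1) fT] fS(3) by (simp add: add_choose_2)
        then show "?q ^ card (edges_within S \<union> edges_within T) = ?q ^ ((k choose 2) + (a * b + (b choose 2)))"
          by simp
      qed
      also have "\<dots> = real (card ?R) * ?q ^ ((k choose 2) + (a * b + (b choose 2)))"
        by simp
      also have "\<dots> \<le> real ((k choose a) * (n choose b)) * ?q ^ ((k choose 2) + (a * b + (b choose 2)))"
      proof (intro mult_right_mono of_nat_mono)
        have "card ?R \<le> card {T. T \<subseteq> {1..n} \<and> card (T \<inter> S) = a \<and> card (T - S) = b}"
          by (rule card_mono) (auto simp: R_def ab)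
        also have "\<dots> = (k choose a) * ((n - k) choose b)"
          using card_subsets_meeting[of "{1..n}" S a b] fS by simp
        also have "\<dots> \<le> (k choose a) * (n choose b)"
          by (intro mult_left_mono binomial_right_mono) auto
        finally show "card ?R \<le> (k choose a) * (n choose b)" .
      qed (use p in auto)
      finally show "(\<Sum>T\<in>?R. ?q ^ card (edges_within S \<union> edges_within T)) \<le> ?q ^ (k choose 2) *
          (real (k choose fst ab) * real (n choose snd ab) * ?q ^ (fst ab * snd ab + (snd ab choose 2)))"
        by (simp add: ab power_add mult_ac)
    qed
    finally show "(\<Sum>T\<in>R S. ?q ^ card (edges_within S \<union> edges_within T)) \<le> ?q ^ (k choose 2) *
        (\<Sum>(a, b)\<in>D. real (k choose a) * real (n choose b) * ?q ^ (a * b + (b choose 2)))"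
      by (simp add: sum_distrib_left case_prod_unfold)
  qed
  also have "\<dots> = expect_indep p n k *
      (\<Sum>(a, b)\<in>D. real (k choose a) * real (n choose b) * ?q ^ (a * b + (b choose 2)))"
    by (simp add: expect_indep_eq card_vertex_subsets)
  finally show ?thesis .
qed

section \<open>Transfer from the binomial to the uniform model\<close>

text \<open>The binomial distribution with mean \<open>m\<close> has its mode at \<open>m\<close>,
  and the largest of \<open>N + 1\<close> probabilities with sum 1 is at least
  \<open>1 / (N + 1)\<close>.\<close>

lemma binomial_mode:
  assumes "0 < m" "m < N"
  defines "p \<equiv> real m / real N"
  shows "1 \<le> (real N + 1) * (real (N choose m) * p ^ m * (1 - p) ^ (N - m))"
proof -
  define T where "T j = real (N choose j) * p ^ j * (1 - p) ^ (N - j)" for j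
  have p: "0 < p" "p < 1" using assms by (auto simp: p_def)
  have q: "1 - p = real (N - m) / real N"
    using assms by (simp add: p_def field_simps of_nat_diff)
  have T0: "T j \<ge> 0" for j using p by (simp add: T_def)
  \<comment> \<open>The ratio of consecutive terms, cross-multiplied. Whether the terms grow at
    \<open>j\<close> depends on how (N - j) m compares with (j + 1) (N - m).\<close>
  have step: "T (Suc j) * (real (Suc j) * (1 - p)) = T j * (real (N - j) * p)" if "j < N" for j
  proof -
    have "Suc j * (N choose Suc j) = (N - j) * (N choose j)"
      using binomial_absorb_comp[of N j] binomial_absorption[of j N] by simp
    then have c: "real (Suc j) * real (N choose Suc j) = real (N - j) * real (N choose j)"
      by (metis of_nat_mult)
    have "N - j = Suc (N - Suc j)" using that by simp
    then have "T j * (real (N - j) * p)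
        = (real (N - j) * real (N choose j)) * p ^ Suc j * ((1 - p) * (1 - p) ^ (N - Suc j))"
      unfolding T_def by (simp add: mult_ac)
    also have "\<dots> = T (Suc j) * (real (Suc j) * (1 - p))"
      unfolding c[symmetric] T_def by (simp only: mult_ac)
    finally show ?thesis by simp
  qed
  have up: "T j \<le> T (Suc j)" if "j < m" for j
  proof -
    have "real (Suc j) * (1 - p) \<le> real (N - j) * p"
      unfolding q unfolding p_def times_divide_eq_right mult.commute[of "real (N - j)"]
      using that assms(2) by (intro divide_right_mono mult_mono) auto
    then have "T j * (real (Suc j) * (1 - p)) \<le> T j * (real (N - j) * p)"
      using T0 by (intro mult_left_mono)
    also have "\<dots> = T (Suc j) * (real (Suc j) * (1 - p))"
      using step that assms(2) by simp
    finally show ?thesis using p by (simp add: mult_le_cancel_right)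
  qed
  have down: "T (Suc j) \<le> T j" if "m \<le> j" "j < N" for j
  proof -
    have "real (N - j) * p \<le> real (Suc j) * (1 - p)"
      unfolding q unfolding p_def times_divide_eq_right mult.commute[of "real (N - j)"]
      using that assms(2) by (intro divide_right_mono mult_mono) auto
    then have "T j * (real (N - j) * p) \<le> T j * (real (Suc j) * (1 - p))"
      using T0 by (intro mult_left_mono)
    then have "T (Suc j) * (real (Suc j) * (1 - p)) \<le> T j * (real (Suc j) * (1 - p))"
      using step[OF that(2)] by simp
    then show ?thesis using p by (simp add: mult_le_cancel_right)
  qed
  have "T j \<le> T m" if "j \<le> N" for j
  proof (cases "j \<le> m")
    case True
    then show ?thesis by (induction rule: inc_induct) (use up in \<open>auto intro: order_trans\<close>)
  next
    case False
    then have "m \<le> j" by simp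
    then show ?thesis using \<open>j \<le> N\<close>
    proof (induction rule: dec_induct)
      case (step i)
      then show ?case using down[of i] by linarith
    qed simp
  qed
  then have "(\<Sum>j\<le>N. T j) \<le> (\<Sum>j\<le>N. T m)"
    by (intro sum_mono) auto
  moreover have "(\<Sum>j\<le>N. T j) = (p + (1 - p)) ^ N"
    unfolding T_def binomial_ring ..
  ultimately show ?thesis
    by (simp add: T_def algebra_simps)
qed

text \<open>Conditioned on having \<open>m\<close> elements, the binomial random subset is uniform.
  By \<open>binomial_mode\<close> the conditioning costs at most the factor
  \<open>card X + 1\<close> for a nonnegative \<open>f\<close>.\<close>

lemma uniform_le_subset_expect:
  fixes f :: "'a set \<Rightarrow> real"
  assumes "finite X" "0 < m" "m < card X" "\<And>E. E \<subseteq> X \<Longrightarrow> 0 \<le> f E"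
  shows "(\<Sum>E | E \<subseteq> X \<and> card E = m. f E) / real (card X choose m)
    \<le> (real (card X) + 1) * subset_expect (real m / real (card X)) X f"
proof -
  define p where "p = real m / real (card X)"
  let ?N = "card X" and ?G = "{E. E \<subseteq> X \<and> card E = m}"
  have p: "0 < p" "p < 1" using assms by (auto simp: p_def)
  have C: "real (?N choose m) > 0" using assms by simp
  have "(\<Sum>E\<in>?G. f E) * (p ^ m * (1 - p) ^ (?N - m)) = (\<Sum>E\<in>?G. p ^ card E * (1 - p) ^ card (X - E) * f E)"
    unfolding sum_distrib_right using assms(1)
    by (intro sum.cong) (auto simp: card_Diff_subset finite_subset)
  also have "\<dots> \<le> subset_expect p X f"
    unfolding subset_expect_def using p assms(1,4) by (intro sum_mono2) auto
  finally have le: "(\<Sum>E\<in>?G. f E) * (p ^ m * (1 - p) ^ (?N - m)) \<le> subset_expect p X f" .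
  have "(\<Sum>E\<in>?G. f E) / real (?N choose m) * 1
      \<le> (\<Sum>E\<in>?G. f E) / real (?N choose m) * ((real ?N + 1) * (real (?N choose m) * p ^ m * (1 - p) ^ (?N - m)))"
    unfolding p_def using assms
    by (intro mult_left_mono binomial_mode divide_nonneg_nonneg sum_nonneg) auto
  also have "\<dots> = (real ?N + 1) * ((\<Sum>E\<in>?G. f E) * (p ^ m * (1 - p) ^ (?N - m)))"
    using C by simp
  also have "\<dots> \<le> (real ?N + 1) * subset_expect p X f"
    by (intro mult_left_mono le) auto
  finally show ?thesis by (simp add: p_def)
qed

text \<open>Given a graph with at least \<open>L\<close> independent sets, the failing fraction is
  at most the number of failing sets over \<open>L\<close>; otherwise the failure probability is
  bounded by 1. The outcome \<open>None\<close> counts as failure and falls into the second case as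
  \<open>L > 0\<close>.\<close>

lemma prob_U_ge:
  fixes L :: real
  assumes m: "m \<le> n choose 2" and L: "L > 0"
  shows "1 - measure_pmf.prob (U n m k) {x. case x of None \<Rightarrow> False | Some (E, S) \<Rightarrow> good E S}
    \<le> (\<Sum>E\<in>graphs n m. of_bool (real (card (indep_sets n E k)) < L)
          + real (card {S \<in> indep_sets n E k. \<not> good E S}) / L) / card (graphs n m)"
proof -
  let ?S = "{x. case x of None \<Rightarrow> False | Some (E, S) \<Rightarrow> good E S}"
  let ?I = "\<lambda>E. indep_sets n E k"
  define f where "f E = (if ?I E = {} then return_pmf None
      else map_pmf (\<lambda>S. Some (E, S)) (pmf_of_set (?I E)))" for E
  have fin: "finite (graphs n m)"
    unfolding graphs_def by (rule finite_subset[of _ "Pow (all_edges n)"]) (auto simp: finite_all_edges)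
  have ne: "graphs n m \<noteq> {}"
  proof -
    obtain E where "E \<subseteq> all_edges n" "card E = m"
      using obtain_subset_with_card_n[of m "all_edges n"] m by (auto simp: card_all_edges)
    then show ?thesis by (auto simp: graphs_def)
  qed
  have "1 - measure_pmf.prob (U n m k) ?S = measure_pmf.prob (U n m k) (- ?S)"
    using measure_pmf.prob_compl[of ?S "U n m k"] by (simp add: Compl_eq_Diff_UNIV)
  also have "\<dots> = measure_pmf.expectation (pmf_of_set (graphs n m) \<bind> f) (indicator (- ?S))"
    by (simp add: U_def Gnm_def f_def[abs_def])
  also have "\<dots> = (\<Sum>E\<in>graphs n m. measure_pmf.expectation (f E) (indicator (- ?S)) /\<^sub>R real (card (graphs n m)))"
    by (rule pmf_expectation_bind_pmf_of_set[OF ne fin]) (simp add: f_def finite_indep_sets)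
  also have "\<dots> = (\<Sum>E\<in>graphs n m. measure_pmf.prob (f E) (- ?S)) / card (graphs n m)"
    by (simp add: sum_distrib_left divide_inverse mult.commute)
  also have "\<dots> \<le> (\<Sum>E\<in>graphs n m. of_bool (real (card (?I E)) < L)
          + real (card {S \<in> ?I E. \<not> good E S}) / L) / card (graphs n m)"
  proof (intro divide_right_mono sum_mono)
    fix E
    show "measure_pmf.prob (f E) (- ?S)
        \<le> of_bool (real (card (?I E)) < L) + real (card {S \<in> ?I E. \<not> good E S}) / L"
    proof (cases "real (card (?I E)) < L")
      case True
      then show ?thesis
        using measure_pmf.prob_le_1[of "f E" "- ?S"] L by (simp add: add_increasing2)
    next
      case False
      then have I: "?I E \<noteq> {}" using L by auto
      then have "measure_pmf.prob (f E) (- ?S) = card (?I E \<inter> {S. \<not> good E S}) / card (?I E)"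
        by (simp add: f_def measure_pmf_of_set finite_indep_sets vimage_def)
      also have "?I E \<inter> {S. \<not> good E S} = {S \<in> ?I E. \<not> good E S}"
        by auto
      also have "real (card {S \<in> ?I E. \<not> good E S}) / card (?I E) \<le> card {S \<in> ?I E. \<not> good E S} / L"
        using False L by (intro divide_left_mono) auto
      finally show ?thesis using False by simp
    qed
  qed simp
  finally show ?thesis .
qed

section \<open>Exponential estimates\<close>

lemma choose_2_le: "real (l choose 2) \<le> (real l)\<^sup>2 / 2"
  by (induction l) (auto simp: numeral_2_eq_2 power2_eq_square algebra_simps)

text \<open>Overlaps \<open>l \<le> \<rho> * k\<close> are bounded trivially, which costs the exponential factor; for larger
  overlaps the hypotheses \<open>small\<close> and \<open>large\<close> make the term at most 1.\<close>

lemma overlap_count_le: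
  fixes \<nu> \<rho> \<kappa> :: real and n k l :: nat
  defines "\<kappa> \<equiv> real k / real n"
  assumes n: "n > 0" "k \<le> n" and l: "l \<le> k" and \<nu>: "\<nu> \<ge> 0" and \<rho>: "\<rho> > 0"
    and small: "exp 1 * \<kappa> / \<rho> * exp (\<nu> * \<kappa> / 16) \<le> 1"
    and large: "8 * exp 1 * \<kappa> * exp (\<nu> * \<kappa> / 2) \<le> 1"
  shows "real ((k choose l) * ((n - k) choose (k - l)))
    \<le> exp (n * (\<nu> * \<rho>\<^sup>2 * \<kappa>\<^sup>2 / 2)) * (n choose k) * exp (- (\<nu> / n)) ^ (l choose 2)"
proof -
  have edges: "exp (- (\<nu> * l\<^sup>2 / (2 * n))) \<le> exp (- (\<nu> / n)) ^ (l choose 2)"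
  proof -
    have "\<nu> / n * real (l choose 2) \<le> \<nu> / n * (l\<^sup>2 / 2)"
      using \<nu> choose_2_le[of l] by (intro mult_left_mono) auto
    then show ?thesis
      by (simp add: exp_of_nat_mult[symmetric] mult.commute)
  qed
  have \<kappa>0: "\<kappa> \<ge> 0" by (simp add: \<kappa>_def)
  show ?thesis
  proof (cases "l \<le> \<rho> * k")
    case True
    \<comment> \<open>The trivial bound: one term of Vandermonde's sum for
      \<open>n choose k\<close>.\<close>
    have "(k choose l) * ((n - k) choose (k - l)) \<le> (\<Sum>j\<le>k. (k choose j) * ((n - k) choose (k - j)))"
      using l by (intro member_le_sum) auto
    then have C: "(k choose l) * ((n - k) choose (k - l)) \<le> n choose k"
      using n by (simp add: vandermonde)
    have "(real l)\<^sup>2 \<le> (\<rho> * k)\<^sup>2"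
      using True by (intro power_mono) auto
    then have "\<nu> / (2 * n) * (real l)\<^sup>2 \<le> \<nu> / (2 * n) * (\<rho> * k)\<^sup>2"
      using \<nu> by (intro mult_left_mono) auto
    also have "\<dots> = n * (\<nu> * \<rho>\<^sup>2 * \<kappa>\<^sup>2 / 2)"
      using n by (simp add: \<kappa>_def power2_eq_square field_simps)
    finally have "1 \<le> exp (n * (\<nu> * \<rho>\<^sup>2 * \<kappa>\<^sup>2 / 2)) * exp (- (\<nu> * l\<^sup>2 / (2 * n)))"
      by (simp add: exp_add[symmetric])
    also have "\<dots> \<le> exp (n * (\<nu> * \<rho>\<^sup>2 * \<kappa>\<^sup>2 / 2)) * exp (- (\<nu> / n)) ^ (l choose 2)"
      by (intro mult_left_mono edges) auto
    finally have "real (n choose k) * 1 \<le>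
        real (n choose k) * (exp (n * (\<nu> * \<rho>\<^sup>2 * \<kappa>\<^sup>2 / 2)) * exp (- (\<nu> / n)) ^ (l choose 2))"
      by (intro mult_left_mono) auto
    moreover have "real ((k choose l) * ((n - k) choose (k - l))) \<le> real (n choose k)"
      using C by (simp only: of_nat_le_iff)
    ultimately show ?thesis by (simp add: mult_ac)
  next
    case False
    then have l0: "real l > 0" using \<rho> by (smt (verit) mult_nonneg_nonneg of_nat_0_le_iff)
    then have k0: "real k > 0" using l by linarith
    have n0: "real n > 0" using n by simp
    \<comment> \<open>The count is at most \<open>(n choose k) * B ^ l\<close>, so it suffices to
      compare \<open>B\<close> with the \<open>l\<close>-th root of the edge factor.\<close>
    define B where "B = exp 1 * k / l * \<kappa>"
    \<comment> \<open>Up to \<open>k / 8\<close> the exponent is small while \<open>k / l\<close> is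
      only known to be below \<open>1 / \<rho>\<close>; beyond, \<open>k / l\<close> is below 8 and
      the exponent may be as large as \<open>\<nu> * \<kappa> / 2\<close>. These cases use
      \<open>small\<close> and \<open>large\<close> respectively.\<close>
    have B: "B * exp (\<nu> * l / (2 * n)) \<le> 1"
    proof (cases "l \<le> k / 8")
      case True
      have "B * exp (\<nu> * l / (2 * n)) \<le> (exp 1 * \<kappa> / \<rho>) * exp (\<nu> * \<kappa> / 16)"
      proof (rule mult_mono)
        have "k / l \<le> 1 / \<rho>" using False l0 \<rho> by (simp add: field_simps)
        then have "exp 1 * \<kappa> * (k / l) \<le> exp 1 * \<kappa> * (1 / \<rho>)"
          using \<kappa>0 by (intro mult_left_mono) auto
        then show "B \<le> exp 1 * \<kappa> / \<rho>" by (simp add: B_def mult_ac)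
        have "\<nu> * l \<le> \<nu> * (k / 8)" using True \<nu> by (intro mult_left_mono)
        then show "exp (\<nu> * l / (2 * n)) \<le> exp (\<nu> * \<kappa> / 16)"
          using n0 by (simp add: \<kappa>_def field_simps)
      qed (use \<kappa>0 \<rho> in auto)
      then show ?thesis using small by linarith
    next
      case False
      have "B * exp (\<nu> * l / (2 * n)) \<le> (8 * exp 1 * \<kappa>) * exp (\<nu> * \<kappa> / 2)"
      proof (rule mult_mono)
        have "k / l \<le> 8" using False l0 by (simp add: field_simps)
        then have "exp 1 * \<kappa> * (k / l) \<le> exp 1 * \<kappa> * 8"
          using \<kappa>0 by (intro mult_left_mono) auto
        then show "B \<le> 8 * exp 1 * \<kappa>" by (simp add: B_def mult_ac)
        have "\<nu> * l \<le> \<nu> * k" using l \<nu> by (intro mult_left_mono) auto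
        then show "exp (\<nu> * l / (2 * n)) \<le> exp (\<nu> * \<kappa> / 2)"
          using n0 by (simp add: \<kappa>_def field_simps)
      qed (use \<kappa>0 in auto)
      then show ?thesis using large by linarith
    qed
    have "real ((k choose l) * ((n - k) choose (k - l)))
        \<le> (exp 1 * k / l) ^ l * (real (n choose k) * \<kappa> ^ l)"
    proof -
      have "real ((n - k) choose (k - l)) \<le> real ((n - l) choose (k - l))"
        using l by (intro of_nat_mono binomial_right_mono) auto
      also have "\<dots> \<le> real (n choose k) * \<kappa> ^ l"
        unfolding \<kappa>_def using binomial_shift_le[OF l n(2,1)] .
      finally show ?thesis
        unfolding of_nat_mult using binomial_le_power_exp[of k l] by (intro mult_mono) auto
    qed
    also have "\<dots> = real (n choose k) * B ^ l"
      by (simp only: B_def power_mult_distrib mult_ac)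
    also have "\<dots> \<le> real (n choose k) * exp (- (\<nu> * l\<^sup>2 / (2 * n)))"
    proof (rule mult_left_mono)
      have "(B * exp (\<nu> * l / (2 * n))) ^ l \<le> 1"
        using B \<kappa>0 by (intro power_le_one) (auto simp: B_def)
      then have "B ^ l * exp (\<nu> * l\<^sup>2 / (2 * n)) \<le> 1"
        by (simp add: power_mult_distrib exp_of_nat_mult[symmetric] power2_eq_square mult_ac)
      then show "B ^ l \<le> exp (- (\<nu> * l\<^sup>2 / (2 * n)))"
        by (simp add: exp_minus field_simps)
    qed simp
    also have "\<dots> \<le> real (n choose k) * exp (- (\<nu> / n)) ^ (l choose 2)"
      by (intro mult_left_mono edges) auto
    also have "\<dots> \<le> exp (n * (\<nu> * \<rho>\<^sup>2 * \<kappa>\<^sup>2 / 2)) * (real (n choose k) * exp (- (\<nu> / n)) ^ (l choose 2))"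
      using \<nu> mult_right_mono[of 1 "exp (n * (\<nu> * \<rho>\<^sup>2 * \<kappa>\<^sup>2 / 2))"
        "real (n choose k) * exp (- (\<nu> / n)) ^ (l choose 2)"] by simp
    finally show ?thesis by (simp add: mult_ac)
  qed
qed

text \<open>The exponent \<open>a * b + (b choose 2)\<close> equals b ((2 a + b) / 2 - 1 / 2), so
  the term is bounded by the \<open>b\<close>-th power of the quantity in \<open>bracket\<close>.
  Each of the more than \<open>\<eta> * k\<close> new vertices thus gains a factor
  \<open>exp (- x)\<close>.\<close>

lemma extension_term_le:
  fixes \<nu> \<eta> x \<theta> :: real
  assumes "n > 0" "k > 0" "\<eta> > 0" "\<nu> \<ge> 0" "x \<ge> 0"
    and b: "\<eta> * k < b" and ab: "2 * \<theta> < 2 * real a + b"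
    and bracket: "2 powr (1 / \<eta>) * (exp 1 * n / (\<eta> * k)) * exp (- (\<nu> / n * (\<theta> - 1 / 2))) \<le> exp (- x)"
  shows "real (k choose a) * real (n choose b) * exp (- (\<nu> / n)) ^ (a * b + (b choose 2))
    \<le> exp (- (x * \<eta> * k))"
proof -
  have b0: "real b > 0" using b assms(2,3) by (smt (verit) mult_pos_pos of_nat_0_less_iff)
  \<comment> \<open>As \<open>b > \<eta> k\<close>, the choice of the intersection costs only a constant factor per vertex outside.\<close>
  have "real (k choose a) \<le> 2 powr k"
    using binomial_le_pow2[of k a] by (simp add: powr_realpow)
  also have "\<dots> \<le> 2 powr (1 / \<eta> * b)"
    using b assms(3) by (intro powr_mono) (auto simp: field_simps)
  also have "\<dots> = (2 powr (1 / \<eta>)) ^ b"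
    by (simp only: powr_powr[symmetric]) (simp add: powr_realpow)
  finally have ka: "real (k choose a) \<le> (2 powr (1 / \<eta>)) ^ b" .
  have "real (n choose b) \<le> (exp 1 * n / b) ^ b"
    by (rule binomial_le_power_exp)
  also have "\<dots> \<le> (exp 1 * n / (\<eta> * k)) ^ b"
    using b assms(2,3) b0 by (intro power_mono divide_left_mono) auto
  finally have nb: "real (n choose b) \<le> (exp 1 * n / (\<eta> * k)) ^ b" .
  have "real (b choose 2) = real b * (real b - 1) / 2"
    by (induction b) (auto simp: numeral_2_eq_2 field_simps)
  then have "real (a * b + (b choose 2)) = b * ((2 * real a + b) / 2 - 1 / 2)"
    by (simp add: field_simps)
  also have "\<dots> \<ge> b * (\<theta> - 1 / 2)"
    using ab b0 by (intro mult_left_mono) auto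
  finally have "\<nu> / n * (b * (\<theta> - 1 / 2)) \<le> \<nu> / n * real (a * b + (b choose 2))"
    using assms(4) by (intro mult_left_mono) auto
  then have "exp (- (\<nu> / n)) ^ (a * b + (b choose 2)) \<le> exp (- (\<nu> / n * (\<theta> - 1 / 2))) ^ b"
    by (simp only: exp_of_nat_mult[symmetric]) (simp add: mult_ac)
  with ka nb have "real (k choose a) * real (n choose b) * exp (- (\<nu> / n)) ^ (a * b + (b choose 2))
      \<le> (2 powr (1 / \<eta>)) ^ b * (exp 1 * n / (\<eta> * k)) ^ b * exp (- (\<nu> / n * (\<theta> - 1 / 2))) ^ b"
    using assms(2,3) by (intro mult_mono) auto
  also have "\<dots> = (2 powr (1 / \<eta>) * (exp 1 * n / (\<eta> * k)) * exp (- (\<nu> / n * (\<theta> - 1 / 2)))) ^ b"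
    by (simp only: power_mult_distrib)
  also have "\<dots> \<le> exp (- x) ^ b"
    using assms(2,3) by (intro power_mono bracket) auto
  also have "\<dots> = exp (- (x * b))"
    by (simp add: exp_of_nat_mult[symmetric] mult.commute)
  also have "\<dots> \<le> exp (- (x * \<eta> * k))"
    using b assms(5) mult_left_mono[of "\<eta> * k" b x] by (simp add: mult_ac)
  finally show ?thesis .
qed

text \<open>Here 2 a + b is \<open>card T + card (T \<inter> S)\<close>, at least (2 + \<gamma> -
  \<delta>) k by expandability. The bound on \<open>\<delta>\<close> turns this into 2 (1 + \<eta>)
  k / (1 + \<epsilon>), since 1 + \<epsilon> - (\<epsilon> - \<eta>) = 1 + \<eta>. The bound on b
  follows from \<open>\<gamma> > \<eta>\<close> and a \<le> k.\<close>

lemma expandable_overlap: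
  fixes \<epsilon> \<eta> \<gamma> \<delta> :: real
  assumes "expandable n E S \<gamma> \<delta>" "S \<subseteq> {1..n}" "card S = k" "k > 0"
    and "\<gamma> > \<eta>" "\<delta> < \<gamma> + 2 * (\<epsilon> - \<eta>) / (1 + \<epsilon>)" "\<epsilon> > - 1"
  shows "\<exists>T. is_indep n E T \<and> (card (T \<inter> S), card (T - S)) \<in>
    {(a, b). a \<le> k \<and> b \<le> n \<and> \<eta> * k < b \<and> 2 * ((1 + \<eta>) * k / (1 + \<epsilon>)) < 2 * real a + b}"
proof -
  obtain T where T: "is_indep n E T" "real (card T) \<ge> (1 + \<gamma>) * k" "real (card (T \<inter> S)) \<ge> (1 - \<delta>) * k"
    using assms(1,3) by (auto simp: expandable_def)
  have fS: "finite S" using assms(2) finite_subset by blast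
  have TV: "T \<subseteq> {1..n}" using T(1) by (simp add: is_indep_def)
  then have fT: "finite T" by (auto intro: finite_subset)
  let ?a = "card (T \<inter> S)" and ?b = "card (T - S)"
  have "card T = ?a + ?b"
    using fT by (metis Int_Diff_disjoint Int_Diff_Un card_Un_disjoint finite_Diff finite_Int)
  then have cT: "real (card T) = real ?a + real ?b" by simp
  have a: "?a \<le> k" using fS assms(3) by (metis card_mono inf_le2)
  have b: "?b \<le> n" using card_mono[of "{1..n}" "T - S"] TV by auto
  have "(1 + \<gamma>) * k > (1 + \<eta>) * k" using assms(4,5) by simp
  then have "\<eta> * k < ?b" using T(2) cT a by (simp add: algebra_simps)
  moreover have "2 * ((1 + \<eta>) * k / (1 + \<epsilon>)) < 2 * real ?a + ?b"
  proof -
    have "2 * ((1 + \<eta>) * k / (1 + \<epsilon>)) = (2 - 2 * (\<epsilon> - \<eta>) / (1 + \<epsilon>)) * k"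
      using assms(7) by (simp add: field_simps)
    also have "\<dots> < (2 + \<gamma> - \<delta>) * k"
      using assms(4,6) by (intro mult_strict_right_mono) auto
    also have "\<dots> = (1 + \<gamma>) * k + (1 - \<delta>) * k" by (simp add: algebra_simps)
    finally show ?thesis using T(2,3) cT by linarith
  qed
  ultimately show ?thesis using T(1) a b by blast
qed

text \<open>Below the middle the binomial coefficients increase, and going from \<open>k\<close> to
  \<open>k + w\<close> vertices adds at most \<open>(k + w) * w\<close> pairs. This relates the
  first moment at size \<open>k\<close> to the lower tail threshold, which is set at size
  \<open>k + w\<close>.\<close>

lemma expect_indep_ratio_le:
  fixes \<nu> :: real
  assumes "n > 0" "\<nu> \<ge> 0" "2 * (k + w) \<le> n"
  shows "expect_indep (1 - exp (- (\<nu> / n))) n k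
    \<le> expect_indep (1 - exp (- (\<nu> / n))) n (k + w) * exp (\<nu> / n * ((k + w) * w))"
proof -
  have "(w choose 2) + k * w \<le> (k + w) * w"
    by (induction w) (auto simp: numeral_2_eq_2)
  then have "\<nu> / n * real ((w choose 2) + k * w) \<le> \<nu> / n * real ((k + w) * w)"
    using assms by (intro mult_left_mono of_nat_mono) auto
  then have "exp (- (\<nu> / n)) ^ ((w choose 2) + k * w) * exp (\<nu> / n * ((k + w) * w)) \<ge> 1"
    by (simp only: exp_of_nat_mult[symmetric] exp_add[symmetric]) (simp add: algebra_simps)
  then have 1: "exp (- (\<nu> / n)) ^ (k choose 2) * 1
      \<le> exp (- (\<nu> / n)) ^ (k choose 2) * (exp (- (\<nu> / n)) ^ ((w choose 2) + k * w) * exp (\<nu> / n * ((k + w) * w)))"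
    by (intro mult_left_mono) auto
  have "real (n choose k) \<le> real (n choose (k + w))"
    using assms by (intro of_nat_mono binomial_mono) auto
  then have "real (n choose k) * (exp (- (\<nu> / n)) ^ (k choose 2) * 1) \<le> real (n choose (k + w)) *
     (exp (- (\<nu> / n)) ^ (k choose 2) * (exp (- (\<nu> / n)) ^ ((w choose 2) + k * w) * exp (\<nu> / n * ((k + w) * w))))"
    using 1 by (intro mult_mono) auto
  then show ?thesis
    by (simp add: expect_indep_eq add_choose_2 power_add mult_ac)
qed

text \<open>The first exponential is the lower tail, with \<open>M\<close> taken from
  \<open>overlap_count_le\<close>; the second is the expected number of expandable sets over the
  threshold \<open>L\<close>. The polynomial factor covers the transfer between the models and the
  number of overlap sizes (a, b).\<close>

lemma failure_prob_le:
  fixes \<nu> \<rho> t \<eta> x \<epsilon> :: real and n m k w :: nat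
  defines "\<kappa> \<equiv> real k / real n" and "\<omega> \<equiv> real w / real n" and "\<kappa>' \<equiv> real (k + w) / real n"
  assumes n: "n > 0" and k: "k > 0" and kw: "2 * (k + w) \<le> n"
    and m: "0 < m" "m < n choose 2"
    and \<nu>: "\<nu> \<ge> 0" "1 - real m / real (n choose 2) = exp (- (\<nu> / n))"
    and \<rho>: "\<rho> > 0" and t: "0 < t" "t \<le> \<omega>" and \<eta>: "\<eta> > 0" and x: "x \<ge> 0" and \<epsilon>: "\<epsilon> > -1"
    and small: "exp 1 * \<kappa>' / \<rho> * exp (\<nu> * \<kappa>' / 16) \<le> 1"
    and large: "8 * exp 1 * \<kappa>' * exp (\<nu> * \<kappa>' / 2) \<le> 1"
    and bracket: "2 powr (1 / \<eta>) * (exp 1 * n / (\<eta> * k)) *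
      exp (- (\<nu> / n * ((1 + \<eta>) * k / (1 + \<epsilon>) - 1 / 2))) \<le> exp (- x)"
  shows "1 - measure_pmf.prob (U n m k)
      {x. case x of None \<Rightarrow> False | Some (E, \<sigma>) \<Rightarrow>
        (\<forall>\<gamma> \<delta>. \<gamma> \<ge> 0 \<and> \<delta> \<ge> 0 \<and> \<gamma> > \<eta> \<and> \<delta> < \<gamma> + 2 * (\<epsilon> - \<eta>) / (1 + \<epsilon>) \<longrightarrow>
          \<not> expandable n E \<sigma> \<gamma> \<delta>)}
    \<le> 4 * (real n + 1) ^ 4 * (exp (n * (\<nu> * \<rho>\<^sup>2 * \<kappa>'\<^sup>2 / 2 + t\<^sup>2 / 4 - t * \<omega>))
        + exp (n * (\<omega> * (1 - ln t) + \<nu> * \<kappa>' * \<omega> - x * \<eta> * \<kappa>)))"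
    (is "1 - measure_pmf.prob _ {x. case x of None \<Rightarrow> False | Some (E, \<sigma>) \<Rightarrow> ?good E \<sigma>} \<le> _")
proof -
  let ?N = "n choose 2" and ?X = "all_edges n" and ?I = "\<lambda>E. indep_sets n E k"
  define p where "p = real m / real ?N"
  define L where "L = expect_indep p n (k + w) / (2 * real (n choose w))"
  define F1 where "F1 = exp (n * (\<nu> * \<rho>\<^sup>2 * \<kappa>'\<^sup>2 / 2 + t\<^sup>2 / 4 - t * \<omega>))"
  define F2 where "F2 = exp (n * (\<omega> * (1 - ln t) + \<nu> * \<kappa>' * \<omega> - x * \<eta> * \<kappa>))"
  define D where "D = {(a, b). a \<le> k \<and> b \<le> n \<and> \<eta> * k < b \<and> 2 * ((1 + \<eta>) * k / (1 + \<epsilon>)) < 2 * real a + b}"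
  have "0 < real ?N" "real m < real ?N" "0 < real m"
    using m by linarith+
  then have p: "0 < p" "p < 1"
    unfolding p_def by (metis divide_pos_pos, metis divide_less_eq_1_pos)
  have q: "1 - p = exp (- (\<nu> / n))" using \<nu>(2) by (simp add: p_def)
  have p_eq: "p = 1 - exp (- (\<nu> / n))" using q by simp
  have n0: "real n > 0" using n by simp
  have \<mu>: "expect_indep p n (k + w) > 0" "expect_indep p n k \<ge> 0" using p kw by (auto simp: expect_indep_eq)
  have C: "real (n choose w) > 0" using kw by simp
  have L: "L > 0" using \<mu> C by (simp add: L_def)
  have sub: "D \<subseteq> {..k} \<times> {..n}" by (auto simp: D_def)
  then have fD: "finite D" by (rule finite_subset) auto
  have "card D \<le> (k + 1) * (n + 1)"
    using card_mono[OF _ sub] by (simp add: card_cartesian_product)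
  also have "\<dots> \<le> (n + 1) * (n + 1)"
    using kw by (intro mult_right_mono) auto
  finally have "real (card D) \<le> real ((n + 1) * (n + 1))"
    by (rule of_nat_mono)
  then have cD: "real (card D) \<le> (real n + 1)\<^sup>2"
    by (simp add: power2_eq_square algebra_simps)

  have few: "subset_expect p ?X (\<lambda>E. of_bool (real (card (?I E)) < L)) \<le> 4 * (real n + 1) * F1"
  proof -
    have "subset_expect p ?X (\<lambda>E. of_bool (real (card (?I E)) < L))
        \<le> 4 * (real k + real w + 1) * exp (n * (\<nu> * \<rho>\<^sup>2 * \<kappa>'\<^sup>2 / 2)) * exp (n * t\<^sup>2 / 4 - t * w)"
      unfolding L_def
    proof (rule card_indep_sets_lower_tail[OF p])
      fix l assume "l \<le> k + w"
      then show "real ((k + w choose l) * (n - (k + w) choose (k + w - l)))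
          \<le> exp (n * (\<nu> * \<rho>\<^sup>2 * \<kappa>'\<^sup>2 / 2)) * (n choose (k + w)) * (1 - p) ^ (l choose 2)"
        unfolding q \<kappa>'_def
        by (intro overlap_count_le) (use n kw \<nu> \<rho> small large in \<open>auto simp: \<kappa>'_def\<close>)
    qed (use t kw in auto)
    also have "\<dots> = 4 * (real k + real w + 1) * F1"
      using n0 by (simp add: F1_def \<omega>_def exp_add[symmetric] algebra_simps add_divide_distrib diff_divide_distrib)
    also have "\<dots> \<le> 4 * (real n + 1) * F1"
      using kw by (intro mult_right_mono) (auto simp: F1_def)
    finally show ?thesis .
  qed

  have bad: "subset_expect p ?X (\<lambda>E. real (card {\<sigma> \<in> ?I E. \<not> ?good E \<sigma>}) / L) \<le> 2 * (real n + 1)\<^sup>2 * F2"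
  proof -
    have sub: "{\<sigma> \<in> ?I E. \<not> ?good E \<sigma>}
        \<subseteq> {S \<in> ?I E. \<exists>T. is_indep n E T \<and> (card (T \<inter> S), card (T - S)) \<in> D}" for E
    proof
      fix S assume "S \<in> {\<sigma> \<in> ?I E. \<not> ?good E \<sigma>}"
      then obtain \<gamma> \<delta> where S: "S \<in> ?I E"
        and "expandable n E S \<gamma> \<delta>" "\<gamma> > \<eta>" "\<delta> < \<gamma> + 2 * (\<epsilon> - \<eta>) / (1 + \<epsilon>)"
        by blast
      moreover have "S \<subseteq> {1..n}" "card S = k"
        using S by (auto simp: indep_sets_def is_indep_def)
      ultimately have "\<exists>T. is_indep n E T \<and> (card (T \<inter> S), card (T - S)) \<in> D"
        unfolding D_def using k \<epsilon> by (intro expandable_overlap)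
      with S show "S \<in> {S \<in> ?I E. \<exists>T. is_indep n E T \<and> (card (T \<inter> S), card (T - S)) \<in> D}"
        by blast
    qed
    have "subset_expect p ?X (\<lambda>E. real (card {\<sigma> \<in> ?I E. \<not> ?good E \<sigma>}) / L)
        \<le> subset_expect p ?X (\<lambda>E. 1 / L *
          real (card {S \<in> ?I E. \<exists>T. is_indep n E T \<and> (card (T \<inter> S), card (T - S)) \<in> D}))"
    proof (rule subset_expect_mono)
      fix E
      have "card {\<sigma> \<in> ?I E. \<not> ?good E \<sigma>}
          \<le> card {S \<in> ?I E. \<exists>T. is_indep n E T \<and> (card (T \<inter> S), card (T - S)) \<in> D}"
        by (rule card_mono[OF _ sub]) (simp add: finite_indep_sets)
      then show "real (card {\<sigma> \<in> ?I E. \<not> ?good E \<sigma>}) / L \<le> 1 / L *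
          real (card {S \<in> ?I E. \<exists>T. is_indep n E T \<and> (card (T \<inter> S), card (T - S)) \<in> D})"
        using L by (simp add: divide_right_mono)
    qed (use p in auto)
    also have "\<dots> \<le> 1 / L * (expect_indep p n k * (\<Sum>(a, b)\<in>D.
        real (k choose a) * real (n choose b) * (1 - p) ^ (a * b + (b choose 2))))"
      unfolding subset_expect_cmult using p fD L
      by (intro mult_left_mono expect_overlapping_pairs_le) auto
    also have "\<dots> \<le> 1 / L * (expect_indep p n k * (\<Sum>(a, b)\<in>D. exp (- (x * \<eta> * k))))"
    proof (intro mult_left_mono sum_mono)
      fix ab assume "ab \<in> D"
      then obtain a b where "ab = (a, b)" "\<eta> * k < b" "2 * ((1 + \<eta>) * k / (1 + \<epsilon>)) < 2 * real a + b"
        by (auto simp: D_def)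
      then show "(case ab of (a, b) \<Rightarrow> real (k choose a) * real (n choose b) * (1 - p) ^ (a * b + (b choose 2)))
          \<le> (case ab of (a, b) \<Rightarrow> exp (- (x * \<eta> * k)))"
        unfolding q using extension_term_le[OF n k \<eta> \<nu>(1) x _ _ bracket] by simp
    qed (use L \<mu> in auto)
    also have "\<dots> \<le> 1 / L * (expect_indep p n k * ((real n + 1)\<^sup>2 * exp (- (x * \<eta> * k))))"
      using cD L \<mu> by (intro mult_left_mono) (auto simp: case_prod_unfold mult_right_mono)
    \<comment> \<open>Passing to size \<open>k + w\<close> makes the expectation cancel against the
      one in \<open>L\<close>, leaving \<open>n choose w\<close>.\<close>
    also have "\<dots> \<le> 1 / L * ((expect_indep p n (k + w) * exp (\<nu> / n * ((real k + real w) * real w))) *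
        ((real n + 1)\<^sup>2 * exp (- (x * \<eta> * k))))"
      unfolding p_eq using L n kw \<nu>
      by (intro mult_left_mono mult_right_mono expect_indep_ratio_le) auto
    also have "\<dots> = 2 * (real n + 1)\<^sup>2 * (real (n choose w) * (exp (\<nu> / n * ((real k + real w) * real w)) * exp (- (x * \<eta> * k))))"
      using \<mu>(1) C unfolding L_def by (simp add: field_simps)
    also have "\<dots> \<le> 2 * (real n + 1)\<^sup>2 * (exp (w * (1 - ln t)) * (exp (\<nu> / n * ((real k + real w) * real w)) * exp (- (x * \<eta> * k))))"
    proof (intro mult_left_mono mult_right_mono)
      have w: "real w > 0" using t n0 by (cases "w = 0") (auto simp: \<omega>_def)
      have "real (n choose w) \<le> (exp 1 * n / w) ^ w" by (rule binomial_le_power_exp)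
      also have "\<dots> \<le> (exp 1 / t) ^ w"
      proof (rule power_mono)
        have "t * n \<le> w" using t n0 by (simp add: \<omega>_def field_simps)
        then show "exp 1 * n / w \<le> exp 1 / t" using t w by (simp add: field_simps)
      qed simp
      also have "exp 1 / t = exp (1 - ln t)" using t by (simp add: exp_diff)
      finally show "real (n choose w) \<le> exp (w * (1 - ln t))"
        by (simp add: exp_of_nat_mult)
    qed auto
    also have "\<dots> = 2 * (real n + 1)\<^sup>2 * F2"
    proof -
      have "real w * (1 - ln t) + (\<nu> / n * ((real k + real w) * real w) + - (x * \<eta> * k))
          = n * (\<omega> * (1 - ln t) + \<nu> * \<kappa>' * \<omega> - x * \<eta> * \<kappa>)"
        using n0 by (simp add: \<omega>_def \<kappa>'_def \<kappa>_def field_simps)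
      then show ?thesis unfolding F2_def by (simp only: exp_add[symmetric])
    qed
    finally show ?thesis .
  qed

  have cg: "card (graphs n m) = ?N choose m"
    unfolding graphs_def using n_subsets[OF finite_all_edges, of n m] by (simp add: card_all_edges)
  have "1 - measure_pmf.prob (U n m k) {x. case x of None \<Rightarrow> False | Some (E, \<sigma>) \<Rightarrow> ?good E \<sigma>}
      \<le> (\<Sum>E\<in>graphs n m. of_bool (real (card (?I E)) < L) + real (card {\<sigma> \<in> ?I E. \<not> ?good E \<sigma>}) / L)
        / card (graphs n m)"
    by (rule prob_U_ge[OF _ L]) (use m in simp)
  also have "\<dots> \<le> (real ?N + 1) * subset_expect p ?X
      (\<lambda>E. of_bool (real (card (?I E)) < L) + real (card {\<sigma> \<in> ?I E. \<not> ?good E \<sigma>}) / L)"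
    unfolding cg unfolding p_def graphs_def card_all_edges[symmetric]
    by (rule uniform_le_subset_expect) (use m L in \<open>auto simp: finite_all_edges card_all_edges\<close>)
  also have "\<dots> \<le> (real ?N + 1) * (4 * (real n + 1) * F1 + 2 * (real n + 1)\<^sup>2 * F2)"
    unfolding subset_expect_add by (intro mult_left_mono add_mono few bad) auto
  also have "\<dots> \<le> (real n + 1)\<^sup>2 * (4 * (real n + 1)\<^sup>2 * F1 + 4 * (real n + 1)\<^sup>2 * F2)"
  proof (rule mult_mono[OF _ add_mono])
    show "real ?N + 1 \<le> (real n + 1)\<^sup>2"
      using choose_2_le[of n] by (simp add: power2_eq_square algebra_simps)
    show "4 * (real n + 1) * F1 \<le> 4 * (real n + 1)\<^sup>2 * F1"
      by (rule mult_right_mono) (auto simp: F1_def power2_eq_square algebra_simps)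
    show "2 * (real n + 1)\<^sup>2 * F2 \<le> 4 * (real n + 1)\<^sup>2 * F2"
      by (intro mult_right_mono) (auto simp: F2_def)
  qed (auto simp: F1_def F2_def)
  also have "\<dots> = 4 * (real n + 1) ^ 4 * (F1 + F2)"
  proof -
    have "a\<^sup>2 * (4 * a\<^sup>2 * b + 4 * a\<^sup>2 * c) = 4 * a ^ 4 * (b + c)" for a b c :: real
      by (simp add: algebra_simps power2_eq_square power4_eq_xxxx)
    then show ?thesis .
  qed
  finally show ?thesis
    unfolding F1_def F2_def .
qed

section \<open>The limit in the number of vertices\<close>

lemma floor_linear_limit:
  fixes c :: real
  assumes "c \<ge> 0"
  shows "(\<lambda>n. real (nat \<lfloor>c * real n\<rfloor>) / real n) \<longlonglongrightarrow> c"
proof (rule tendsto_sandwich)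
  show "\<forall>\<^sub>F n in sequentially. c - 1 / real n \<le> real (nat \<lfloor>c * real n\<rfloor>) / real n"
    using eventually_gt_at_top[of 0]
  proof eventually_elim
    case (elim n)
    have "c * real n - 1 \<le> real (nat \<lfloor>c * real n\<rfloor>)" using assms by linarith
    then have "(c * real n - 1) / real n \<le> real (nat \<lfloor>c * real n\<rfloor>) / real n"
      by (intro divide_right_mono) auto
    with elim show ?case by (simp add: diff_divide_distrib)
  qed
  show "\<forall>\<^sub>F n in sequentially. real (nat \<lfloor>c * real n\<rfloor>) / real n \<le> c"
    using eventually_gt_at_top[of 0]
  proof eventually_elim
    case (elim n)
    have "0 \<le> c * real n" using assms by simp
    then have "real (nat \<lfloor>c * real n\<rfloor>) \<le> c * real n" by linarith
    with elim show ?case by (simp add: field_simps)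
  qed
  show "(\<lambda>n. c - 1 / real n) \<longlonglongrightarrow> c" by real_asymp
qed simp

lemma poly_times_exp_linear_limit:
  fixes f :: "nat \<Rightarrow> real"
  assumes "f \<longlonglongrightarrow> c" "c < 0"
  shows "(\<lambda>n. (real n + 1) ^ 4 * exp (real n * f n)) \<longlonglongrightarrow> 0"
proof (rule tendsto_sandwich[OF _ _ tendsto_const])
  have "\<forall>\<^sub>F n in sequentially. f n < c / 2"
    using assms by (intro order_tendstoD) auto
  then show "\<forall>\<^sub>F n in sequentially. (real n + 1) ^ 4 * exp (real n * f n) \<le> (real n + 1) ^ 4 * exp (real n * (c / 2))"
    by eventually_elim (intro mult_left_mono iffD2[OF exp_le_cancel_iff], auto)
  show "(\<lambda>n. (real n + 1) ^ 4 * exp (real n * (c / 2))) \<longlonglongrightarrow> 0"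
    using assms(2) by real_asymp
qed auto

text \<open>The rate \<nu> = - n ln (1 - p) makes 1 - p = exp (- \<nu> / n) exact. It tends to
  \<open>d\<close> because n p does and - ln (1 - x) / x tends to 1.\<close>

lemma edge_rate_limit:
  fixes d :: real
  assumes d: "d > 0"
  defines "p \<equiv> \<lambda>n. real (nat \<lfloor>d * real n / 2\<rfloor>) / real (n choose 2)"
  shows "p \<longlonglongrightarrow> 0" "(\<lambda>n. - real n * ln (1 - p n)) \<longlonglongrightarrow> d" "\<forall>\<^sub>F n in sequentially. p n > 0"
proof -
  define r where "r n = real (nat \<lfloor>(d / 2) * real n\<rfloor>) / real n" for n
  have r: "r \<longlonglongrightarrow> d / 2"
    unfolding r_def using d by (intro floor_linear_limit) auto
  have p_eq: "\<forall>\<^sub>F n in sequentially. p n = r n * (2 / (real n - 1))"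
    using eventually_gt_at_top[of 1]
  proof eventually_elim
    case (elim n)
    have edges: "real (n choose 2) = real n * (real n - 1) / 2"
      by (induction n) (auto simp: numeral_2_eq_2 field_simps)
    show ?case unfolding p_def r_def edges by simp
  qed
  have "(\<lambda>n. r n * (2 / (real n - 1))) \<longlonglongrightarrow> d / 2 * 0"
    by (intro tendsto_mult r) real_asymp
  then show p0: "p \<longlonglongrightarrow> 0"
    using tendsto_cong[OF p_eq] by simp
  have "\<forall>\<^sub>F n in sequentially. r n > 0"
    using order_tendstoD(1)[OF r, of 0] d by simp
  then show pos: "\<forall>\<^sub>F n in sequentially. p n > 0"
    using p_eq eventually_gt_at_top[of 1] by eventually_elim auto
  have "(\<lambda>n. r n * (2 * real n / (real n - 1))) \<longlonglongrightarrow> d / 2 * 2"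
    by (intro tendsto_mult r) real_asymp
  moreover have "\<forall>\<^sub>F n in sequentially. r n * (2 * real n / (real n - 1)) = real n * p n"
    using p_eq by eventually_elim simp
  ultimately have np: "(\<lambda>n. real n * p n) \<longlonglongrightarrow> d"
    using Lim_transform_eventually by fastforce
  have "filterlim p (at_right 0) sequentially"
    using p0 pos by (simp add: filterlim_at eventually_mono)
  moreover have "((\<lambda>x::real. - ln (1 - x) / x) \<longlongrightarrow> 1) (at_right 0)"
    by real_asymp
  ultimately have "(\<lambda>n. - ln (1 - p n) / p n) \<longlonglongrightarrow> 1"
    by (rule filterlim_compose[rotated])
  from tendsto_mult[OF np this] have "(\<lambda>n. real n * p n * (- ln (1 - p n) / p n)) \<longlonglongrightarrow> d"
    by simp
  then show "(\<lambda>n. - real n * ln (1 - p n)) \<longlonglongrightarrow> d"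
    by (rule Lim_transform_eventually) (use pos in \<open>eventually_elim, simp\<close>)
qed

text \<open>The numerical conditions are strict, so by continuity they persist for large
  \<open>n\<close> with the actual densities. \<open>moment\<close> and \<open>gain\<close> make the
  two exponents of \<open>failure_prob_le\<close> negative. As \<open>t\<close> is both the
  parameter of the blow-up and the fraction of vertices given up, the first exponent contains t^2 /
  4 - t^2, whence the 3/4.\<close>

lemma not_expandable_whp:
  fixes d \<epsilon> \<eta> \<rho> t x :: real
  defines "\<kappa> \<equiv> (1 + \<epsilon>) * ln d / d"
  assumes d: "d > 1" and \<eta>: "\<eta> > 0" and \<epsilon>: "\<epsilon> > -1" and \<rho>: "\<rho> > 0" and t: "0 < t" "t < 1" and x: "x \<ge> 0"
    and half: "\<kappa> + t < 1 / 2"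
    and small: "exp 1 * (\<kappa> + t) / \<rho> * exp (d * (\<kappa> + t) / 16) < 1"
    and large: "8 * exp 1 * (\<kappa> + t) * exp (d * (\<kappa> + t) / 2) < 1"
    and bracket: "2 powr (1 / \<eta>) * (exp 1 / (\<eta> * \<kappa>)) * exp (- (d * (1 + \<eta>) * \<kappa> / (1 + \<epsilon>))) < exp (- x)"
    and moment: "d * \<rho>\<^sup>2 * (\<kappa> + t)\<^sup>2 / 2 < 3 * t\<^sup>2 / 4"
    and gain: "t * (1 - ln t) + d * (\<kappa> + t) * t < x * \<eta> * \<kappa>"
  shows "(\<lambda>n. measure_pmf.prob (U n (nat \<lfloor>d * real n / 2\<rfloor>) (nat \<lfloor>(1 + \<epsilon>) * ln d / d * real n\<rfloor>))
      {x. case x of None \<Rightarrow> False | Some (E, \<sigma>) \<Rightarrow>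
        (\<forall>\<gamma> \<delta>. \<gamma> \<ge> 0 \<and> \<delta> \<ge> 0 \<and> \<gamma> > \<eta> \<and> \<delta> < \<gamma> + 2 * (\<epsilon> - \<eta>) / (1 + \<epsilon>) \<longrightarrow>
          \<not> expandable n E \<sigma> \<gamma> \<delta>)}) \<longlonglongrightarrow> 1"
    (is "?prob \<longlonglongrightarrow> 1")
proof -
  define m where "m n = nat \<lfloor>d * real n / 2\<rfloor>" for n :: nat
  define k where "k n = nat \<lfloor>\<kappa> * real n\<rfloor>" for n :: nat
  \<comment> \<open>The \<open>+ 1\<close> guarantees \<open>t \<le> b n\<close>, which rounding
    down would not.\<close>
  define w where "w n = nat \<lfloor>t * real n\<rfloor> + 1" for n :: nat
  define p where "p n = real (m n) / real (n choose 2)" for n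
  define \<nu> where "\<nu> n = - real n * ln (1 - p n)" for n
  define a where "a n = real (k n) / real n" for n
  define b where "b n = real (w n) / real n" for n
  define c where "c n = real (k n + w n) / real n" for n
  have \<kappa>: "\<kappa> > 0" using d \<epsilon> by (simp add: \<kappa>_def)
  have p0: "p \<longlonglongrightarrow> 0" and \<nu>: "\<nu> \<longlonglongrightarrow> d" and ppos: "\<forall>\<^sub>F n in sequentially. p n > 0"
    using edge_rate_limit[of d] d by (simp_all add: p_def[abs_def] m_def[abs_def] \<nu>_def[abs_def])
  have a: "a \<longlonglongrightarrow> \<kappa>"
    unfolding a_def k_def using \<kappa> by (intro floor_linear_limit) auto
  have b: "b \<longlonglongrightarrow> t"
  proof -
    have "(\<lambda>n. real (nat \<lfloor>t * real n\<rfloor>) / real n + 1 / real n) \<longlonglongrightarrow> t + 0"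
      using t by (intro tendsto_add floor_linear_limit) (auto, real_asymp)
    then show ?thesis by (simp add: b_def[abs_def] w_def add_divide_distrib add.commute)
  qed
  have c: "c \<longlonglongrightarrow> \<kappa> + t"
    using tendsto_add[OF a b] by (simp add: a_def b_def c_def[abs_def] add_divide_distrib)
  \<comment> \<open>The term 1/2 coming from \<open>b choose 2\<close> becomes
    \<open>1 / (2 * real n)\<close> after scaling and vanishes in the limit.\<close>
  have \<theta>: "(\<lambda>n. \<nu> n * ((1 + \<eta>) / (1 + \<epsilon>) * a n - 1 / (2 * real n))) \<longlonglongrightarrow> d * ((1 + \<eta>) / (1 + \<epsilon>) * \<kappa> - 0)"
    by (intro tendsto_intros \<nu> a) real_asymp
  have e1: "\<forall>\<^sub>F n in sequentially. exp 1 * c n / \<rho> * exp (\<nu> n * c n / 16) < 1"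
    by (rule order_tendstoD(2)[OF _ small]) (use \<rho> in \<open>intro tendsto_intros \<nu> c; simp\<close>)
  have e2: "\<forall>\<^sub>F n in sequentially. 8 * exp 1 * c n * exp (\<nu> n * c n / 2) < 1"
    by (rule order_tendstoD(2)[OF _ large]) (intro tendsto_intros \<nu> c; simp)
  have e3: "\<forall>\<^sub>F n in sequentially. 2 powr (1 / \<eta>) * (exp 1 / (\<eta> * a n)) *
      exp (- (\<nu> n * ((1 + \<eta>) / (1 + \<epsilon>) * a n - 1 / (2 * real n)))) < exp (- x)"
  proof (rule order_tendstoD(2))
    show "(\<lambda>n. 2 powr (1 / \<eta>) * (exp 1 / (\<eta> * a n)) *
        exp (- (\<nu> n * ((1 + \<eta>) / (1 + \<epsilon>) * a n - 1 / (2 * real n))))) \<longlonglongrightarrow>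
      2 powr (1 / \<eta>) * (exp 1 / (\<eta> * \<kappa>)) * exp (- (d * ((1 + \<eta>) / (1 + \<epsilon>) * \<kappa> - 0)))"
      using \<eta> \<kappa> by (intro tendsto_intros a \<theta>) auto
    show "2 powr (1 / \<eta>) * (exp 1 / (\<eta> * \<kappa>)) * exp (- (d * ((1 + \<eta>) / (1 + \<epsilon>) * \<kappa> - 0))) < exp (- x)"
      using bracket by (simp add: mult_ac)
  qed
  have e4: "\<forall>\<^sub>F n in sequentially. c n < 1 / 2"
    by (rule order_tendstoD(2)[OF c half])
  have e5: "\<forall>\<^sub>F n in sequentially. a n > 0"
    by (rule order_tendstoD(1)[OF a \<kappa>])
  have e6: "\<forall>\<^sub>F n in sequentially. p n < 1"
    by (rule order_tendstoD(2)[OF p0]) simp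
  have e7: "\<forall>\<^sub>F n in sequentially. \<nu> n > 0"
    by (rule order_tendstoD(1)[OF \<nu>]) (use d in simp)
  define R where "R n = 4 * (real n + 1) ^ 4 * (exp (n * (\<nu> n * \<rho>\<^sup>2 * (c n)\<^sup>2 / 2 + t\<^sup>2 / 4 - t * b n))
      + exp (n * (b n * (1 - ln t) + \<nu> n * c n * b n - x * \<eta> * a n)))" for n :: nat
  have R: "R \<longlonglongrightarrow> 0"
  proof -
    have 1: "(\<lambda>n. (real n + 1) ^ 4 * exp (n * (\<nu> n * \<rho>\<^sup>2 * (c n)\<^sup>2 / 2 + t\<^sup>2 / 4 - t * b n))) \<longlonglongrightarrow> 0"
    proof (rule poly_times_exp_linear_limit)
      show "(\<lambda>n. \<nu> n * \<rho>\<^sup>2 * (c n)\<^sup>2 / 2 + t\<^sup>2 / 4 - t * b n) \<longlonglongrightarrow> d * \<rho>\<^sup>2 * (\<kappa> + t)\<^sup>2 / 2 + t\<^sup>2 / 4 - t * t"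
        by (intro tendsto_intros \<nu> c b) simp
      show "d * \<rho>\<^sup>2 * (\<kappa> + t)\<^sup>2 / 2 + t\<^sup>2 / 4 - t * t < 0"
        using moment by (simp add: power2_eq_square)
    qed
    have 2: "(\<lambda>n. (real n + 1) ^ 4 * exp (n * (b n * (1 - ln t) + \<nu> n * c n * b n - x * \<eta> * a n))) \<longlonglongrightarrow> 0"
    proof (rule poly_times_exp_linear_limit)
      show "(\<lambda>n. b n * (1 - ln t) + \<nu> n * c n * b n - x * \<eta> * a n) \<longlonglongrightarrow>
          t * (1 - ln t) + d * (\<kappa> + t) * t - x * \<eta> * \<kappa>"
        by (intro tendsto_intros \<nu> c b a)
    qed (use gain in simp)
    have "(\<lambda>n. 4 * ((real n + 1) ^ 4 * exp (n * (\<nu> n * \<rho>\<^sup>2 * (c n)\<^sup>2 / 2 + t\<^sup>2 / 4 - t * b n))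
        + (real n + 1) ^ 4 * exp (n * (b n * (1 - ln t) + \<nu> n * c n * b n - x * \<eta> * a n)))) \<longlonglongrightarrow> 4 * (0 + 0)"
      by (intro tendsto_intros 1 2)
    then show ?thesis by (simp add: R_def[abs_def] distrib_left mult_ac)
  qed
  have k_eq: "nat \<lfloor>(1 + \<epsilon>) * ln d / d * real n\<rfloor> = k n" for n
    by (simp add: k_def \<kappa>_def)
  have lower: "\<forall>\<^sub>F n in sequentially. 1 - R n \<le> ?prob n"
    using e1 e2 e3 e4 e5 e6 e7 ppos eventually_gt_at_top[of 0]
  proof eventually_elim
    case (elim n)
    have n0: "real n > 0" using elim by simp
    have kpos: "k n > 0" using elim(5) by (cases "k n = 0") (auto simp: a_def)
    have "0 < m n" "m n < n choose 2"
    proof -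
      show "0 < m n" using elim(8) by (cases "m n = 0") (auto simp: p_def)
      have "real (n choose 2) > 0"
        using elim(8) unfolding p_def by (metis divide_eq_0_iff less_irrefl of_nat_0_le_iff order_le_less)
      then show "m n < n choose 2" using elim(6) unfolding p_def by (simp only: divide_less_eq_1_pos of_nat_less_iff)
    qed
    moreover have "1 - p n = exp (- (\<nu> n / n))"
      using elim(6) n0 by (simp add: \<nu>_def)
    moreover have "2 * (k n + w n) \<le> n"
    proof -
      have "real (2 * (k n + w n)) \<le> real n" using elim(4) n0 by (simp add: c_def field_simps)
      then show ?thesis by (simp only: of_nat_le_iff)
    qed
    moreover have "t \<le> b n"
    proof -
      have "t * real n \<le> real (w n)" unfolding w_def using t n0 by (simp add: le_nat_floor) linarith
      then show ?thesis using n0 by (simp add: b_def field_simps)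
    qed
    moreover have "2 powr (1 / \<eta>) * (exp 1 * n / (\<eta> * k n)) *
        exp (- (\<nu> n / n * ((1 + \<eta>) * k n / (1 + \<epsilon>) - 1 / 2))) \<le> exp (- x)"
    proof -
      have "exp 1 * n / (\<eta> * k n) = exp 1 / (\<eta> * a n)"
        using n0 by (simp add: a_def)
      moreover have "\<nu> n / n * ((1 + \<eta>) * k n / (1 + \<epsilon>) - 1 / 2) = \<nu> n * ((1 + \<eta>) / (1 + \<epsilon>) * a n - 1 / (2 * real n))"
      proof -
        have "u / n * (y * z - 1 / 2) = u * (y * (z / n) - 1 / (2 * real n))" for u y z :: real
          using n0 by (simp add: field_simps)
        from this[of "\<nu> n" "(1 + \<eta>) / (1 + \<epsilon>)" "k n"] show ?thesis
          by (simp add: a_def)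
      qed
      ultimately show ?thesis using elim(3) by simp
    qed
    ultimately have "1 - ?prob n \<le> R n"
      unfolding R_def a_def b_def c_def k_eq m_def[symmetric]
      using elim t \<eta> x \<epsilon> \<rho> kpos
      by (intro failure_prob_le) (auto simp: p_def b_def c_def)
    then show ?case by linarith
  qed
  show ?thesis
  proof (rule tendsto_sandwich[OF lower _ _ tendsto_const])
    show "(\<lambda>n. 1 - R n) \<longlonglongrightarrow> 1"
      using tendsto_diff[OF tendsto_const R, of 1] by simp
  qed (auto intro: always_eventually)
qed

section \<open>Large average degree\<close>

text \<open>For all admissible \<open>\<epsilon>\<close>, \<open>\<kappa>\<close> lies between ln d
  / d and (2 - \<eta>) ln d / d. The conditions of \<open>not_expandable_whp\<close> thus reduce to
  asymptotics in \<open>d\<close> alone, uniformly in \<open>\<epsilon>\<close>.\<close>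

lemma not_expandable_whp_large_degree:
  fixes \<eta> :: real
  assumes \<eta>: "\<eta> > 0"
  shows "\<forall>\<^sub>F d::real in at_top. \<forall>\<epsilon>. \<eta> \<le> \<epsilon> \<and> \<epsilon> \<le> 1 - \<eta> \<longrightarrow>
    (\<lambda>n. measure_pmf.prob (U n (nat \<lfloor>d * real n / 2\<rfloor>) (nat \<lfloor>(1 + \<epsilon>) * ln d / d * real n\<rfloor>))
      {x. case x of None \<Rightarrow> False | Some (E, \<sigma>) \<Rightarrow>
        (\<forall>\<gamma> \<delta>. \<gamma> \<ge> 0 \<and> \<delta> \<ge> 0 \<and> \<gamma> > \<eta> \<and> \<delta> < \<gamma> + 2 * (\<epsilon> - \<eta>) / (1 + \<epsilon>) \<longrightarrow>
          \<not> expandable n E \<sigma> \<gamma> \<delta>)}) \<longlonglongrightarrow> 1"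
proof -
  \<comment> \<open>With \<open>\<rho> = d powr (-2/3)\<close>, the choice of \<open>t\<close> has to satisfy \<open>\<rho>\<^sup>2 ln\<^sup>2 d / d \<ll> t\<^sup>2\<close> (concentration) and
    \<open>t ln d \<ll> ln\<^sup>2 d / d\<close> (the loss from giving up \<open>t n\<close> vertices stays below the first-moment gain).\<close>
  define t :: "real \<Rightarrow> real" where "t d = d powr (-11/10)" for d
  define K where "K d = 2 * (ln d / d) + t d" for d
  have "\<forall>\<^sub>F d::real in at_top. t d < 1"
    unfolding t_def by real_asymp
  moreover have "\<forall>\<^sub>F d in at_top. K d < 1 / 2"
    unfolding K_def t_def by real_asymp
  \<comment> \<open>Up to logarithms, the powers of \<open>d\<close> are -1 from \<open>K d\<close>,
    2/3 from \<open>\<rho>\<close> and 1/8 from the exponential, in total -5/24. In the comparison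
    with \<open>(t d)\<^sup>2\<close> below they are -7/3 against -11/5.\<close>
  moreover have "\<forall>\<^sub>F d in at_top. exp 1 * K d / d powr (-2/3) * exp (d * K d / 16) < 1"
    unfolding K_def t_def by real_asymp
  moreover have "\<forall>\<^sub>F d in at_top.
      8 * exp 1 * (2 * ln d + d powr (-1/10)) * exp (- (\<eta> / 2) * ln d) * exp (d powr (-1/10) / 2) < 1"
    using \<eta> by real_asymp
  moreover have "\<forall>\<^sub>F d in at_top. 2 powr (1 / \<eta>) * (exp 1 / \<eta>) / ln d * exp (- (\<eta> * ln d / 2)) < 1"
    using \<eta> by real_asymp
  moreover have "\<forall>\<^sub>F d in at_top. d * (d powr (-2/3))\<^sup>2 * (K d)\<^sup>2 / 2 < 3 * (t d)\<^sup>2 / 4"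
    unfolding K_def t_def by real_asymp
  moreover have "\<forall>\<^sub>F d in at_top. t d * (1 - ln (t d)) + d * K d * t d < (\<eta> * ln d / 2) * \<eta> * (ln d / d)"
    unfolding K_def t_def using \<eta> by real_asymp
  ultimately show ?thesis
    using eventually_gt_at_top[of 1]
  proof eventually_elim
    case (elim d)
    then have d: "d > 1" "d > 0" and ld: "ln d > 0" by auto
    have t: "t d > 0" using d by (simp add: t_def)
    have dt: "d * t d = d powr (-1/10)"
      using d powr_mult_base[of d "-11/10"] by (simp add: t_def)
    show ?case
    proof (intro allI impI)
      fix \<epsilon> assume "\<eta> \<le> \<epsilon> \<and> \<epsilon> \<le> 1 - \<eta>"
      then have \<epsilon>: "\<eta> \<le> \<epsilon>" "\<epsilon> \<le> 1 - \<eta>" by auto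
      define \<kappa> where "\<kappa> = (1 + \<epsilon>) * ln d / d"
      have "(1 + \<epsilon>) * (ln d / d) \<le> (2 - \<eta>) * (ln d / d)" "1 * (ln d / d) \<le> (1 + \<epsilon>) * (ln d / d)"
        using \<epsilon> \<eta> ld d by (intro mult_right_mono; simp)+
      then have \<kappa>_le: "\<kappa> \<le> (2 - \<eta>) * (ln d / d)" and \<kappa>_ge: "ln d / d \<le> \<kappa>"
        by (simp_all add: \<kappa>_def)
      have "ln d / d > 0" using ld d by simp
      then have \<kappa>0: "\<kappa> > 0" using \<kappa>_ge by linarith
      have "(2 - \<eta>) * (ln d / d) \<le> 2 * (ln d / d)"
        using \<eta> ld d by (intro mult_right_mono) auto
      then have K: "\<kappa> + t d \<le> K d" using \<kappa>_le by (simp add: K_def)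
      show "(\<lambda>n. measure_pmf.prob (U n (nat \<lfloor>d * real n / 2\<rfloor>) (nat \<lfloor>(1 + \<epsilon>) * ln d / d * real n\<rfloor>))
        {x. case x of None \<Rightarrow> False | Some (E, \<sigma>) \<Rightarrow>
          (\<forall>\<gamma> \<delta>. \<gamma> \<ge> 0 \<and> \<delta> \<ge> 0 \<and> \<gamma> > \<eta> \<and> \<delta> < \<gamma> + 2 * (\<epsilon> - \<eta>) / (1 + \<epsilon>) \<longrightarrow>
            \<not> expandable n E \<sigma> \<gamma> \<delta>)}) \<longlonglongrightarrow> 1"
        unfolding \<kappa>_def[symmetric]
      proof (rule not_expandable_whp[where d = d and \<epsilon> = \<epsilon> and \<rho> = "d powr (-2/3)" and t = "t d"
            and x = "\<eta> * ln d / 2", folded \<kappa>_def])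
        show "\<kappa> + t d < 1 / 2" using K elim by linarith
        have "exp 1 * (\<kappa> + t d) / d powr (-2/3) * exp (d * (\<kappa> + t d) / 16)
            \<le> exp 1 * K d / d powr (-2/3) * exp (d * K d / 16)"
          using K \<kappa>0 t d by (intro mult_mono divide_right_mono) auto
        then show "exp 1 * (\<kappa> + t d) / d powr (-2/3) * exp (d * (\<kappa> + t d) / 16) < 1"
          using elim by linarith
        \<comment> \<open>Here \<open>\<epsilon> \<le> 1 - \<eta>\<close> enters: it keeps the
          exponential below d powr (1 - \<eta> / 2), up to a factor tending to 1, so that
          \<open>K d\<close>, of order ln d / d, outweighs it.\<close>
        have "d * (\<kappa> + t d) / 2 \<le> ln d + - (\<eta> / 2) * ln d + d powr (-1/10) / 2"
        proof -
          have "d * \<kappa> \<le> d * ((2 - \<eta>) * (ln d / d))" using \<kappa>_le d by (intro mult_left_mono) auto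
          then have "d * \<kappa> \<le> (2 - \<eta>) * ln d" using d by simp
          then show ?thesis using dt by (simp add: field_simps)
        qed
        then have "exp (d * (\<kappa> + t d) / 2) \<le> exp (ln d + - (\<eta> / 2) * ln d + d powr (-1/10) / 2)"
          by simp
        also have "\<dots> = d * exp (- (\<eta> / 2) * ln d) * exp (d powr (-1/10) / 2)"
          using d by (simp only: exp_add exp_ln)
        finally have "8 * exp 1 * (\<kappa> + t d) * exp (d * (\<kappa> + t d) / 2)
            \<le> 8 * exp 1 * K d * (d * exp (- (\<eta> / 2) * ln d) * exp (d powr (-1/10) / 2))"
          using K \<kappa>0 t by (intro mult_mono) auto
        also have "\<dots> = 8 * exp 1 * (d * K d) * exp (- (\<eta> / 2) * ln d) * exp (d powr (-1/10) / 2)"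
          by (simp only: mult_ac)
        also have "d * K d = 2 * ln d + d powr (-1/10)"
          using d dt by (simp add: K_def distrib_left)
        finally show "8 * exp 1 * (\<kappa> + t d) * exp (d * (\<kappa> + t d) / 2) < 1"
          using elim by linarith
        \<comment> \<open>The edge factor is \<open>1 / d * y * y\<close>: the \<open>1 / d\<close>
          cancels the \<open>d\<close> in 1 / \<kappa>, one \<open>y\<close> absorbs the constants
          depending on \<open>\<eta>\<close>, and the other is the required
          \<open>exp (- x)\<close>.\<close>
        define y where "y = exp (- (\<eta> * ln d / 2))"
        have rate: "exp (- (d * (1 + \<eta>) * \<kappa> / (1 + \<epsilon>))) = 1 / d * y * y"
        proof -
          have "d * u * (v * l / d) / v = u * l" if "v \<noteq> 0" for u v l :: real
            using that d by simp
          then have "d * (1 + \<eta>) * \<kappa> / (1 + \<epsilon>) = (1 + \<eta>) * ln d"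
            unfolding \<kappa>_def using \<epsilon> \<eta> by auto
          also have "\<dots> = ln d + \<eta> * ln d / 2 + \<eta> * ln d / 2"
            by (simp add: distrib_right)
          finally have "d * (1 + \<eta>) * \<kappa> / (1 + \<epsilon>) = ln d + \<eta> * ln d / 2 + \<eta> * ln d / 2" .
          moreover have "exp (- (u + v + v)) = exp (- u) * exp (- v) * exp (- v)" for u v :: real
            by (simp add: exp_add[symmetric])
          moreover have "exp (- ln d) = 1 / d"
            using d by (simp add: exp_minus inverse_eq_divide)
          ultimately show ?thesis unfolding y_def by metis
        qed
        have "2 powr (1 / \<eta>) * (exp 1 / (\<eta> * \<kappa>)) * (1 / d * y * y)
            \<le> 2 powr (1 / \<eta>) * (exp 1 / (\<eta> * (ln d / d))) * (1 / d * y * y)"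
          using \<kappa>_ge \<kappa>0 \<eta> ld d
          by (intro mult_right_mono mult_left_mono divide_left_mono) (auto simp: y_def)
        also have "\<dots> = 2 powr (1 / \<eta>) * (exp 1 / \<eta>) / ln d * y * y"
          using d by simp
        also have "\<dots> < 1 * y"
          using elim by (intro mult_strict_right_mono) (auto simp: y_def)
        finally show "2 powr (1 / \<eta>) * (exp 1 / (\<eta> * \<kappa>)) * exp (- (d * (1 + \<eta>) * \<kappa> / (1 + \<epsilon>)))
            < exp (- (\<eta> * ln d / 2))"
          unfolding rate y_def[symmetric] by simp
        have "d * (d powr (-2/3))\<^sup>2 * (\<kappa> + t d)\<^sup>2 / 2 \<le> d * (d powr (-2/3))\<^sup>2 * (K d)\<^sup>2 / 2"
          using K \<kappa>0 t d by (intro divide_right_mono mult_left_mono power_mono) auto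
        then show "d * (d powr (-2/3))\<^sup>2 * (\<kappa> + t d)\<^sup>2 / 2 < 3 * (t d)\<^sup>2 / 4"
          using elim by linarith
        have "d * (\<kappa> + t d) * t d \<le> d * K d * t d"
          using K d t by (intro mult_right_mono mult_left_mono) auto
        moreover have "(\<eta> * ln d / 2) * \<eta> * (ln d / d) \<le> (\<eta> * ln d / 2) * \<eta> * \<kappa>"
          using \<kappa>_ge \<eta> ld by (intro mult_left_mono) auto
        ultimately show "t d * (1 - ln (t d)) + d * (\<kappa> + t d) * t d < (\<eta> * ln d / 2) * \<eta> * \<kappa>"
          using elim by linarith
      qed (use d \<eta> \<epsilon> t ld elim in auto)
    qed
  qed
qed

text \<open>Diagonal choice: \<open>f d\<close> is 1 / (j + 1) for the largest j \<le> d that is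
  admissible at \<open>d\<close>. The cap j \<le> d makes the maximum exist, \<open>triv\<close>
  provides j = 0, and every fixed j is eventually admissible, so \<open>f\<close> tends to
  0.\<close>

lemma eventually_diagonal:
  fixes P :: "real \<Rightarrow> real \<Rightarrow> bool"
  assumes ev: "\<And>\<eta>. \<eta> > 0 \<Longrightarrow> \<forall>\<^sub>F d in at_top. P d \<eta>" and triv: "\<And>d. d > 0 \<Longrightarrow> P d 1"
  shows "\<exists>f. (f \<longlongrightarrow> 0) at_top \<and> (\<forall>d>0. P d (f d))"
proof -
  define A where "A d = {j::nat. real j \<le> d \<and> P d (1 / real (Suc j))}" for d
  define f where "f d = 1 / real (Suc (Max (A d)))" for d
  have fin: "finite (A d)" for d
    by (rule finite_subset[of _ "{..nat \<lfloor>d\<rfloor>}"]) (auto simp: A_def le_nat_floor)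
  have "P d (f d)" if "d > 0" for d
  proof -
    have "0 \<in> A d" using triv[OF that] that by (simp add: A_def)
    then have "Max (A d) \<in> A d" using fin by (intro Max_in) auto
    then show ?thesis by (simp add: A_def f_def)
  qed
  moreover have "(f \<longlongrightarrow> 0) at_top"
  proof (rule tendstoI)
    fix r :: real assume "r > 0"
    then obtain j where j: "1 / real (Suc j) < r"
      using nat_approx_posE by metis
    have "\<forall>\<^sub>F d in at_top. P d (1 / real (Suc j))"
      by (rule ev) simp
    then have "\<forall>\<^sub>F d in at_top. j \<in> A d"
      using eventually_ge_at_top[of "real j"]
      by eventually_elim (simp add: A_def)
    then show "\<forall>\<^sub>F d in at_top. dist (f d) 0 < r"
    proof eventually_elim
      case (elim d)
      then have "j \<le> Max (A d)" using fin by (intro Max_ge)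
      then have "f d \<le> 1 / real (Suc j)" by (simp add: f_def frac_le)
      then show ?case using j by (simp add: f_def)
    qed
  qed
  ultimately show ?thesis by blast
qed

theorem theorem1p6:
  "\<exists>eps_d :: real \<Rightarrow> real. (eps_d \<longlongrightarrow> 0) at_top \<and>
     (\<forall>d::real. d > 0 \<longrightarrow> (\<forall>\<epsilon>::real. eps_d d \<le> \<epsilon> \<and> \<epsilon> \<le> 1 - eps_d d \<longrightarrow>
        (\<lambda>n::nat.
           let m = nat \<lfloor>d * real n / 2\<rfloor>;
               k = nat \<lfloor>(1 + \<epsilon>) * ln d / d * real n\<rfloor>
           in measure_pmf.prob (U n m k)
                {x. case x of None \<Rightarrow> False
                    | Some (E, \<sigma>) \<Rightarrow>
                        (\<forall>\<gamma> \<delta>. \<gamma> \<ge> 0 \<and> \<delta> \<ge> 0 \<and> \<gamma> > eps_d d \<and>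
                           \<delta> < \<gamma> + 2 * (\<epsilon> - eps_d d) / (1 + \<epsilon>) \<longrightarrow>
                           \<not> expandable n E \<sigma> \<gamma> \<delta>)})
        \<longlonglongrightarrow> 1))"
proof -
  define P where "P d \<eta> \<longleftrightarrow> (\<forall>\<epsilon>::real. \<eta> \<le> \<epsilon> \<and> \<epsilon> \<le> 1 - \<eta> \<longrightarrow>
    (\<lambda>n. measure_pmf.prob (U n (nat \<lfloor>d * real n / 2\<rfloor>) (nat \<lfloor>(1 + \<epsilon>) * ln d / d * real n\<rfloor>))
      {x. case x of None \<Rightarrow> False | Some (E, \<sigma>) \<Rightarrow>
        (\<forall>\<gamma> \<delta>. \<gamma> \<ge> 0 \<and> \<delta> \<ge> 0 \<and> \<gamma> > \<eta> \<and> \<delta> < \<gamma> + 2 * (\<epsilon> - \<eta>) / (1 + \<epsilon>) \<longrightarrow>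
          \<not> expandable n E \<sigma> \<gamma> \<delta>)}) \<longlonglongrightarrow> 1)" for d \<eta> :: real
  have "\<exists>eps_d. (eps_d \<longlongrightarrow> 0) at_top \<and> (\<forall>d>0. P d (eps_d d))"
  proof (rule eventually_diagonal)
    show "\<forall>\<^sub>F d in at_top. P d \<eta>" if "\<eta> > 0" for \<eta>
      unfolding P_def by (rule not_expandable_whp_large_degree[OF that])
    \<comment> \<open>The default for small \<open>d\<close>: with \<eta> = 1 the range of
      \<epsilon> is empty.\<close>
    show "P d 1" for d
    proof -
      have "\<not> (1 \<le> \<epsilon> \<and> \<epsilon> \<le> 1 - 1)" for \<epsilon> :: real by linarith
      then show ?thesis unfolding P_def by blast
    qed
  qed
  then show ?thesis
    unfolding P_def Let_def .
qed

end
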